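(* Let $n\geq 3$ and let $K,L\subset\mathbb{R}^n$ be two convex bodies with $L\subset\operatorname{int} K$. Suppose that for every $x\in\partial K$ the graze $\Sigma(L,x)$ is (the relative boundary of) an $(n-1)$-dimensional ellipsoid contained in some hyperplane. Then $L$ is an ellipsoid.
   Context: A convex body is a compact convex set with non-empty interior. For a convex body $L\subset\mathbb{R}^n$ and a point $x\in\mathbb{R}^n\setminus L$, let $C(L,x)=\{x+\lambda(y-x): y\in L,\ \lambda\geq 0\}$ be the cone generated by $L$ with apex $x$, let $S(L,x)=\partial C(L,x)$ be the support cone, and let the graze of $L$ from $x$ be $\Sigma(L,x)=S(L,x)\cap\partial L$. An $(n-1)$-dimensional ellipsoid is a solid ellipsoid with non-empty interior relative to a hyperplane of $\mathbb{R}^n$; its relative boundary is its boundary within that hyperplane (for $n=3$, an ellipse as a curve). *)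

theory Defs
  imports "HOL-Analysis.Analysis"
begin

definition convex_body :: "'a::euclidean_space set \<Rightarrow> bool" where
  "convex_body K \<longleftrightarrow> compact K \<and> convex K \<and> interior K \<noteq> {}"

definition cone_from :: "'a::euclidean_space set \<Rightarrow> 'a \<Rightarrow> 'a set" where
  "cone_from L x = {x + t *\<^sub>R (y - x) | y t. y \<in> L \<and> 0 \<le> t}"

definition support_cone :: "'a::euclidean_space set \<Rightarrow> 'a \<Rightarrow> 'a set" where
  "support_cone L x = frontier (cone_from L x)"

definition graze :: "'a::euclidean_space set \<Rightarrow> 'a \<Rightarrow> 'a set" where
  "graze L x = support_cone L x \<inter> frontier L"

text \<open>
  Solid \<open>k\<close>-dimensional ellipsoids: affine images of the closed unit ball that span a
  \<open>k\<close>-dimensional affine subspace. The linear map is not assumed injective; the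
  dimension condition says that its rank is \<open>k\<close>, so that the image is a
  nondegenerate ellipsoid in its affine hull (with non-empty interior there). Its relative
  boundary is \<^const>\<open>rel_frontier\<close>.
\<close>

definition ellipsoid :: "nat \<Rightarrow> 'a::euclidean_space set \<Rightarrow> bool" where
  "ellipsoid k E \<longleftrightarrow>
     (\<exists>(c::'a) (f::'a \<Rightarrow> 'a). linear f \<and> E = (\<lambda>u. c + f u) ` cball 0 1) \<and> aff_dim E = int k"

end

theory Submission
  imports Defs
begin

text \<open>
  Dualise with respect to an interior point \<open>0\<close> of \<open>L\<close>. If the graze from \<open>x\<close> is the relative
  boundary of \<open>c + f B\<close>, where \<open>B\<close> is the unit ball, then on the hyperplane \<open>{u. x \<bullet> u = 1}\<close> the
  boundary of the polar body of \<open>L\<close> lies on the quadric \<open>norm (f\<^sup>* u) = 1 - c \<bullet> u\<close>. So the sections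
  of the polar of \<open>L\<close> by the hyperplanes supporting the polar of \<open>K\<close> lie on quadrics. For a
  point \<open>p\<close> strictly inside the polar of \<open>L\<close> whose dual hyperplane meets the interior of \<open>K\<close>,
  the quadrics of three such sections through \<open>p\<close> agree on the pairwise intersections (a quadratic
  polynomial on a line through \<open>p\<close> is determined by its value at \<open>p\<close> and two zeros around \<open>p\<close>) and
  hence glue to one quadric, which contains every other such section through \<open>p\<close>. Different points
  \<open>p\<close> yield the same quadric by a connectedness argument on a convex surface between \<open>L\<close> and \<open>K\<close>.
  Therefore the whole boundary of the polar of \<open>L\<close> lies on one quadric, so the support function of
  \<open>L\<close> is \<open>m \<bullet> u + norm (g u)\<close> with \<open>g\<close> linear, and \<open>L\<close> is an ellipsoid.
\<close>

section \<open>Quadratic functions\<close>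

text \<open>\<open>B\<close> need not be symmetric, so a product of two linear forms serves directly
  as quadratic part. Affine functions are included.\<close>

definition quadratic :: "('a::euclidean_space \<Rightarrow> real) \<Rightarrow> bool" where
  "quadratic q \<longleftrightarrow>
     (\<exists>B l c. bilinear B \<and> linear l \<and> q = (\<lambda>u. B u u + l u + c))"

lemma linear_cmult:
  fixes h :: "'a::real_vector \<Rightarrow> real"
  assumes "linear h"
  shows "linear (\<lambda>u. k * h u)"
  using linear_compose_scale_right[OF assms, of k] by simp

lemma quadraticI:
  assumes "bilinear B" "linear l" "\<And>u. q u = B u u + l u + c"
  shows "quadratic q"
  using assms unfolding quadratic_def by blast

lemma quadratic_add:
  assumes "quadratic q" "quadratic r"
  shows "quadratic (\<lambda>u. q u + r u)"
proof -
  obtain B l c B' l' c' where *: "bilinear B" "linear l" "q = (\<lambda>u. B u u + l u + c)"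
    "bilinear B'" "linear l'" "r = (\<lambda>u. B' u u + l' u + c')"
    using assms unfolding quadratic_def by blast
  have "bilinear (\<lambda>u v. B u v + B' u v)"
    using *(1,4) by (simp add: bilinear_def linear_compose_add)
  then show ?thesis
    by (rule quadraticI[where l = "\<lambda>u. l u + l' u" and c = "c + c'"])
      (use * in \<open>simp_all add: linear_compose_add\<close>)
qed

lemma quadratic_cmult:
  assumes "quadratic q"
  shows "quadratic (\<lambda>u. k * q u)"
proof -
  obtain B l c where *: "bilinear B" "linear l" "q = (\<lambda>u. B u u + l u + c)"
    using assms unfolding quadratic_def by blast
  have "bilinear (\<lambda>u v. k * B u v)"
    using *(1) unfolding bilinear_def by (intro conjI allI linear_cmult) auto
  then show ?thesis
    by (rule quadraticI[where l = "\<lambda>u. k * l u" and c = "k * c"])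
      (use * in \<open>simp_all add: algebra_simps linear_cmult\<close>)
qed

lemma quadratic_diff:
  assumes "quadratic q" "quadratic r"
  shows "quadratic (\<lambda>u. q u - r u)"
  using quadratic_add[OF assms(1) quadratic_cmult[OF assms(2), of "- 1"]] by simp

lemma quadratic_affine:
  fixes f :: "'a::euclidean_space \<Rightarrow> 'a"
  assumes "quadratic q" "linear f"
  shows "quadratic (\<lambda>u. q (a + f u))"
proof -
  obtain B l c where *: "bilinear B" "linear l" "q = (\<lambda>u. B u u + l u + c)"
    using assms unfolding quadratic_def by blast
  have B: "linear (\<lambda>u. B u v)" "linear (\<lambda>v. B u v)" for u v
    using *(1) by (auto simp: bilinear_def)
  have lin: "linear (\<lambda>u. g (f u))" if "linear g" for g
    using linear_compose[OF assms(2) that] by (simp add: o_def)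
  have "bilinear (\<lambda>u v. B (f u) (f v))"
    unfolding bilinear_def by (intro conjI allI lin B)
  moreover have "linear (\<lambda>u. B a (f u) + B (f u) a + l (f u))"
    by (intro linear_compose_add lin B *)
  ultimately show ?thesis
    by (rule quadraticI[where c = "B a a + l a + c"])
      (simp add: * bilinear_ladd[OF *(1)] bilinear_radd[OF *(1)] linear_add[OF *(2)])
qed

lemma quadratic_mult:
  assumes "linear f" "linear g"
  shows "quadratic (\<lambda>u. (f u + a) * (g u + b :: real))"
proof -
  have "linear (\<lambda>u. f u * k)" for k
    using linear_cmult[OF assms(1), of k] by (simp add: mult.commute)
  then have "bilinear (\<lambda>u v. f u * g v)"
    using linear_cmult[OF assms(2)] by (simp add: bilinear_def)
  moreover have "linear (\<lambda>u. b * f u + a * g u)"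
    by (intro linear_compose_add linear_cmult assms)
  ultimately show ?thesis
    by (rule quadraticI[where c = "a * b"]) (simp add: algebra_simps)
qed

lemma quadratic_inner:
  assumes "linear g"
  shows "quadratic (\<lambda>u. g u \<bullet> g u)"
proof -
  have "linear (\<lambda>u. g u \<bullet> w)" "linear (\<lambda>u. w \<bullet> g u)" for w
    by (auto intro!: linearI
        simp: linear_add[OF assms] linear_scale[OF assms] inner_add_left inner_add_right)
  then have "bilinear (\<lambda>u v. g u \<bullet> g v)"
    by (simp add: bilinear_def)
  then show ?thesis
    by (rule quadraticI[where l = "\<lambda>u. 0" and c = 0]) (simp_all add: module_hom_zero)
qed

text \<open>The mixed second difference does not depend on the base point: the symmetrised form
  \<open>B x y + B y x\<close> serves for every \<open>a\<close>.\<close>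

lemma quadratic_polarization:
  assumes "quadratic q"
  obtains C where "bilinear C"
    "\<And>a x y. q (a + x + y) = q (a + x) + q (a + y) - q a + C x y"
proof -
  obtain B l c where *: "bilinear B" "linear l" "q = (\<lambda>u. B u u + l u + c)"
    using assms unfolding quadratic_def by blast
  have "bilinear (\<lambda>x y. B x y + B y x)"
    using *(1) by (simp add: bilinear_def linear_compose_add)
  moreover have "q (a + x + y) = q (a + x) + q (a + y) - q a + (B x y + B y x)" for a x y
    by (simp add: * bilinear_ladd[OF *(1)] bilinear_radd[OF *(1)] linear_add[OF *(2)])
  ultimately show ?thesis using that by blast
qed

lemma quadratic_line:
  assumes "quadratic q"
  obtains a b where "\<And>t. q (p + t *\<^sub>R w) = a * t\<^sup>2 + b * t + q p"
proof -
  obtain B l c where *: "bilinear B" "linear l" "q = (\<lambda>u. B u u + l u + c)"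
    using assms unfolding quadratic_def by blast
  have "q (p + t *\<^sub>R w) = B w w * t\<^sup>2 + (B p w + B w p + l w) * t + q p" for t
    by (simp add: * bilinear_ladd[OF *(1)] bilinear_radd[OF *(1)] linear_add[OF *(2)]
        bilinear_lmul[OF *(1)] bilinear_rmul[OF *(1)] linear_scale[OF *(2)]
        algebra_simps power2_eq_square)
  then show ?thesis using that by blast
qed

text \<open>On the line \<open>q\<close> is a polynomial of degree at most two with three distinct
  zeros, at \<open>- t\<close>, \<open>0\<close> and \<open>s\<close>.\<close>

lemma quadratic_zero_on_line:
  assumes "quadratic q" "q p = 0" "q (p + s *\<^sub>R w) = 0" "q (p - t *\<^sub>R w) = 0" "0 < s" "0 < t"
  shows "q (p + r *\<^sub>R w) = 0"
proof -
  obtain a b where ab: "\<And>t. q (p + t *\<^sub>R w) = a * t\<^sup>2 + b * t + q p"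
    using quadratic_line[OF assms(1)] by blast
  have "s * (a * s + b) = 0" using ab[of s] assms by (simp add: power2_eq_square algebra_simps)
  moreover have "t * (a * t - b) = 0"
    using ab[of "- t"] assms by (simp add: power2_eq_square algebra_simps)
  ultimately have "a * s + b = 0" "a * t - b = 0" using assms by auto
  then have "a * (s + t) = 0" "b = a * t" by (auto simp: algebra_simps)
  then have "a = 0" "b = 0" using assms by auto
  with ab assms show ?thesis by simp
qed

text \<open>Vanishing on two hyperplanes forces both linear forms as factors, and degree two leaves
  only a constant cofactor. The vector \<open>e\<close> ensures that on \<open>W\<close> the form
  \<open>a\<close> is not a multiple of \<open>b\<close>.\<close>

lemma quadratic_factor:
  assumes q: "quadratic q" and W: "subspace W"
    and zero: "\<And>w. w \<in> W \<Longrightarrow> a \<bullet> w = 0 \<or> b \<bullet> w = 0 \<Longrightarrow> q (p + w) = 0"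
    and e: "e \<in> W" "a \<bullet> e \<noteq> 0" "b \<bullet> e = 0"
  obtains C where "\<And>w. w \<in> W \<Longrightarrow> q (p + w) = C * (a \<bullet> w) * (b \<bullet> w)"
proof (cases "\<exists>f\<in>W. b \<bullet> f \<noteq> 0")
  case False
  then show ?thesis using zero that[of 0] by auto
next
  case True
  then obtain f0 where f0: "f0 \<in> W" "b \<bullet> f0 \<noteq> 0" by blast
  \<comment> \<open>\<open>e'\<close> and \<open>f\<close> are dual to \<open>a\<close> and
    \<open>b\<close> on \<open>W\<close>; the rest \<open>w0\<close> of a vector lies in both
    kernels. Only the mixed term \<open>B e' f\<close> survives polarization.\<close>
  define e' where "e' = (1 / (a \<bullet> e)) *\<^sub>R e"
  define f where "f = (1 / (b \<bullet> f0)) *\<^sub>R (f0 - (a \<bullet> f0) *\<^sub>R e')"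
  have e': "e' \<in> W" "a \<bullet> e' = 1" "b \<bullet> e' = 0"
    using e W by (auto simp: e'_def subspace_scale)
  have f: "f \<in> W" "a \<bullet> f = 0" "b \<bullet> f = 1"
    using e' f0 W by (auto simp: f_def subspace_scale subspace_diff inner_diff_right)
  obtain B where B: "bilinear B"
    and pol: "\<And>a x y. q (a + x + y) = q (a + x) + q (a + y) - q a + B x y"
    using quadratic_polarization[OF q] by blast
  have q0: "q p = 0" using zero[of 0] W by (simp add: subspace_0)
  have "q (p + w) = B e' f * (a \<bullet> w) * (b \<bullet> w)" if w: "w \<in> W" for w
  proof -
    define w0 where "w0 = w - (a \<bullet> w) *\<^sub>R e' - (b \<bullet> w) *\<^sub>R f"
    have w0: "w0 \<in> W" "a \<bullet> w0 = 0" "b \<bullet> w0 = 0"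
      using e' f W w by (auto simp: w0_def subspace_scale subspace_diff inner_diff_right)
    have "q (p + e' + w0) = 0" "q (p + e') = 0" "q (p + w0) = 0"
      using zero[of "e' + w0"] zero[of e'] zero[of w0] e' w0 W
      by (auto simp: subspace_add inner_add_right add.assoc)
    then have z: "B e' w0 = 0" using pol[of p e' w0] q0 by simp
    have "q (p + w) = q (p + (a \<bullet> w) *\<^sub>R e' + ((b \<bullet> w) *\<^sub>R f + w0))" by (simp add: w0_def)
    moreover have "q (p + (a \<bullet> w) *\<^sub>R e') = 0"
      using zero[of "(a \<bullet> w) *\<^sub>R e'"] e' W by (simp add: subspace_scale)
    moreover have "q (p + ((b \<bullet> w) *\<^sub>R f + w0)) = 0"
      using zero[of "(b \<bullet> w) *\<^sub>R f + w0"] f w0 W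
      by (simp add: subspace_scale subspace_add inner_add_right)
    ultimately show ?thesis
      using pol[of p "(a \<bullet> w) *\<^sub>R e'" "(b \<bullet> w) *\<^sub>R f + w0"] q0 z
      by (simp add: bilinear_radd[OF B] bilinear_lmul[OF B] bilinear_rmul[OF B])
  qed
  then show ?thesis using that by blast
qed

lemma quadratic_zero_of_factor:
  assumes "quadratic q" "subspace W"
    and "\<And>w. w \<in> W \<Longrightarrow> a \<bullet> w = 0 \<or> b \<bullet> w = 0 \<Longrightarrow> q (p + w) = 0"
    and "e \<in> W" "a \<bullet> e \<noteq> 0" "b \<bullet> e = 0"
    and "f \<in> W" "a \<bullet> f \<noteq> 0" "b \<bullet> f \<noteq> 0" "q (p + f) = 0" "w \<in> W"
  shows "q (p + w) = 0"
proof -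
  obtain C where C: "\<And>w. w \<in> W \<Longrightarrow> q (p + w) = C * (a \<bullet> w) * (b \<bullet> w)"
    using quadratic_factor[OF assms(1-6)] by blast
  then have "C = 0" using C[of f] assms by auto
  with C assms show ?thesis by simp
qed

lemma quadratic_glue2:
  assumes q: "quadratic q" and r: "quadratic r"
    and agree: "\<And>w. a \<bullet> w = 0 \<Longrightarrow> b \<bullet> w = 0 \<Longrightarrow> q (p + w) = r (p + w)"
    and e: "a \<bullet> e = 1" "b \<bullet> e = 0" and f: "a \<bullet> f = 0" "b \<bullet> f = 1"
  obtains g where "quadratic g" "\<And>w. a \<bullet> w = 0 \<Longrightarrow> g (p + w) = q (p + w)"
    "\<And>w. b \<bullet> w = 0 \<Longrightarrow> g (p + w) = r (p + w)"
proof -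
  \<comment> \<open>\<open>P\<close> and \<open>R\<close> project onto the two hyperplanes along
    \<open>e\<close> and \<open>f\<close>. Gluing is by inclusion and exclusion: on each hyperplane
    one projection is the identity and the other two terms cancel, on the first because
    \<open>q\<close> and \<open>r\<close> agree on the intersection.\<close>
  define P where "P w = w - (a \<bullet> w) *\<^sub>R e" for w
  define R where "R w = w - (b \<bullet> w) *\<^sub>R f" for w
  have lin: "linear P" "linear R"
    unfolding P_def R_def by (auto intro!: linearI simp: algebra_simps inner_add_right)
  then have linPR: "linear (\<lambda>w. P (R w))" using linear_compose[of R P] by (simp add: o_def)
  have aP: "a \<bullet> P w = 0" and bP: "b \<bullet> P w = b \<bullet> w" and aR: "a \<bullet> R w = a \<bullet> w"
    and bR: "b \<bullet> R w = 0" for w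
    using e f by (auto simp: P_def R_def inner_diff_right)
  have PR: "P (R w) = R (P w)" for w
    by (simp add: P_def[of "R w"] R_def[of "P w"] aR bP) (simp add: P_def R_def)
  have Pid: "a \<bullet> w = 0 \<Longrightarrow> P w = w" and Rid: "b \<bullet> w = 0 \<Longrightarrow> R w = w" for w
    by (auto simp: P_def R_def)
  have shift: "quadratic (\<lambda>u. h (p + F (u - p)))" if "quadratic h" "linear F" for h F
    using quadratic_affine[OF that, of "p - F p"]
    by (simp add: linear_diff[OF that(2)] algebra_simps)
  define g where "g u = q (p + P (u - p)) + r (p + R (u - p)) - q (p + P (R (u - p)))" for u
  have "quadratic g"
    unfolding g_def by (intro quadratic_add quadratic_diff shift q r lin linPR)
  moreover have "g (p + w) = q (p + w)" if "a \<bullet> w = 0" for w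
    using agree[of "R w"] that by (simp add: g_def aR bR Pid)
  moreover have "g (p + w) = r (p + w)" if "b \<bullet> w = 0" for w
    using agree[of "P w"] that by (simp add: g_def aP bP Rid)
  ultimately show ?thesis using that by blast
qed

lemma orthogonal_complement_separates:
  fixes v :: "'a::euclidean_space"
  assumes "v \<notin> span X"
  obtains w where "\<And>x. x \<in> X \<Longrightarrow> x \<bullet> w = 0" "v \<bullet> w \<noteq> 0"
proof -
  obtain y z where yz: "y \<in> span X" "\<And>w. w \<in> span X \<Longrightarrow> orthogonal z w" "v = y + z"
    using orthogonal_subspace_decomp_exists[of X v] by blast
  then have "z \<noteq> 0" using assms by auto
  moreover have "y \<bullet> z = 0" using yz by (simp add: orthogonal_def inner_commute)
  ultimately have "v \<bullet> z \<noteq> 0" using yz by (simp add: inner_add_left)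
  moreover have "x \<bullet> z = 0" if "x \<in> X" for x
    using yz(2)[OF span_base[OF that]] by (simp add: orthogonal_def inner_commute)
  ultimately show ?thesis using that by blast
qed

text \<open>First \<open>Q1\<close> and \<open>Q2\<close> are glued to \<open>h\<close>. On the
  hyperplane of \<open>c\<close> the error \<open>Q3 - h\<close> vanishes where \<open>a\<close> or
  \<open>b\<close> does, so it is a multiple of the product of these forms; adding that product
  everywhere repairs the third hyperplane without disturbing the first two.\<close>

lemma quadratic_glue3:
  assumes Q: "quadratic Q1" "quadratic Q2" "quadratic Q3"
    and Q12: "\<And>w. a \<bullet> w = 0 \<Longrightarrow> b \<bullet> w = 0 \<Longrightarrow> Q1 (p + w) = Q2 (p + w)"
    and Q13: "\<And>w. a \<bullet> w = 0 \<Longrightarrow> c \<bullet> w = 0 \<Longrightarrow> Q1 (p + w) = Q3 (p + w)"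
    and Q23: "\<And>w. b \<bullet> w = 0 \<Longrightarrow> c \<bullet> w = 0 \<Longrightarrow> Q2 (p + w) = Q3 (p + w)"
    and ind: "a \<notin> span {b, c}" "b \<notin> span {a, c}"
  obtains g where "quadratic g" "\<And>w. a \<bullet> w = 0 \<Longrightarrow> g (p + w) = Q1 (p + w)"
    "\<And>w. b \<bullet> w = 0 \<Longrightarrow> g (p + w) = Q2 (p + w)" "\<And>w. c \<bullet> w = 0 \<Longrightarrow> g (p + w) = Q3 (p + w)"
proof -
  obtain e where e: "b \<bullet> e = 0" "c \<bullet> e = 0" "a \<bullet> e \<noteq> 0"
    by (rule orthogonal_complement_separates[OF ind(1)]) auto
  obtain f where f: "a \<bullet> f = 0" "c \<bullet> f = 0" "b \<bullet> f \<noteq> 0"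
    by (rule orthogonal_complement_separates[OF ind(2)]) auto
  obtain h where h: "quadratic h" "\<And>w. a \<bullet> w = 0 \<Longrightarrow> h (p + w) = Q1 (p + w)"
    "\<And>w. b \<bullet> w = 0 \<Longrightarrow> h (p + w) = Q2 (p + w)"
    using quadratic_glue2[OF Q(1,2), of a b p "(1 / (a \<bullet> e)) *\<^sub>R e" "(1 / (b \<bullet> f)) *\<^sub>R f"] Q12 e f
    by auto
  have W: "subspace {w. c \<bullet> w = 0}" by (rule subspace_hyperplane)
  obtain C where C: "\<And>w. w \<in> {w. c \<bullet> w = 0} \<Longrightarrow> Q3 (p + w) - h (p + w) = C * (a \<bullet> w) * (b \<bullet> w)"
    by (rule quadratic_factor[OF quadratic_diff[OF Q(3) h(1)] W, of a b p e])
      (use e h Q13 Q23 in auto)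
  define g where "g u = h u + C * ((a \<bullet> u + (- (a \<bullet> p))) * (b \<bullet> u + (- (b \<bullet> p))))" for u
  have lin: "linear (\<lambda>u. v \<bullet> u)" for v :: 'a
    by (simp add: bounded_linear.linear bounded_linear_inner_right)
  have "quadratic g"
    unfolding g_def by (intro quadratic_add h quadratic_cmult quadratic_mult lin)
  moreover have gw: "g (p + w) = h (p + w) + C * (a \<bullet> w) * (b \<bullet> w)" for w
    by (simp add: g_def inner_add_right)
  moreover have "g (p + w) = Q3 (p + w)" if "c \<bullet> w = 0" for w
    using C[of w] that by (simp add: gw)
  ultimately show ?thesis using that h by auto
qed

text \<open>Two vectors cannot span a space of dimension at least three. Such directions allow
  moving a point while two linear conditions on it are kept.\<close>

lemma orthogonal_direction:
  fixes u v :: "'a::euclidean_space"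
  assumes "3 \<le> DIM('a)"
  obtains w where "w \<noteq> 0" "w \<bullet> u = 0" "w \<bullet> v = 0"
proof -
  have "dim {u, v} < DIM('a)"
    using dim_le_card'[of "{u, v}"] card_insert_le_m1[of 2 "{v}" u] assms by simp
  then obtain w where "w \<noteq> 0" "\<And>y. y \<in> span {u, v} \<Longrightarrow> orthogonal w y"
    using orthogonal_to_subspace_exists by blast
  then show ?thesis using that[of w] by (simp add: orthogonal_def span_base)
qed

section \<open>Polar bodies and slices\<close>

text \<open>For compact \<open>L\<close> this is the interior of the polar body. If \<open>L\<close>
  is convex and contains \<open>0\<close>, its nonzero points are dual to the hyperplanes that miss
  \<open>L\<close>.\<close>

definition open_polar :: "'a::euclidean_space set \<Rightarrow> 'a set" where
  "open_polar L = {u. \<forall>y\<in>L. y \<bullet> u < 1}"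

text \<open>For compact \<open>L\<close> with \<open>0\<close> in its interior this is the boundary
  of the polar body; its points are dual to the supporting hyperplanes of \<open>L\<close>.\<close>

definition polar_frontier :: "'a::euclidean_space set \<Rightarrow> 'a set" where
  "polar_frontier L = {u. (\<forall>y\<in>L. y \<bullet> u \<le> 1) \<and> (\<exists>y\<in>L. y \<bullet> u = 1)}"

lemma open_open_polar:
  assumes "compact L"
  shows "open (open_polar L)"
proof (cases "L = {}")
  case False
  obtain R where R: "R > 0" "\<And>y. y \<in> L \<Longrightarrow> norm y \<le> R"
    using compact_imp_bounded[OF assms] unfolding bounded_pos by blast
  show ?thesis
  proof (rule openI)
    fix u assume u: "u \<in> open_polar L"
    obtain y0 where y0: "y0 \<in> L" "\<And>y. y \<in> L \<Longrightarrow> y \<bullet> u \<le> y0 \<bullet> u"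
      using continuous_attains_sup[OF assms False continuous_on_inner[OF continuous_on_id continuous_on_const]]
      by blast
    have pos: "0 < (1 - y0 \<bullet> u) / R" using u y0 R by (simp add: open_polar_def)
    have "y \<bullet> v < 1" if v: "v \<in> ball u ((1 - y0 \<bullet> u) / R)" and y: "y \<in> L" for v y
    proof -
      have "y \<bullet> (v - u) \<le> norm y * norm (v - u)" by (rule norm_cauchy_schwarz)
      also have "\<dots> \<le> R * norm (v - u)" using R(2)[OF y] by (simp add: mult_right_mono)
      also have "\<dots> < R * ((1 - y0 \<bullet> u) / R)"
        using v R by (intro mult_strict_left_mono) (simp_all add: dist_norm norm_minus_commute)
      finally show ?thesis using y0(2)[OF y] R by (simp add: inner_diff_right)
    qed
    then have "ball u ((1 - y0 \<bullet> u) / R) \<subseteq> open_polar L" by (auto simp: open_polar_def)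
    with pos show "\<exists>T>0. ball u T \<subseteq> open_polar L" by blast
  qed
qed (simp add: open_polar_def)

text \<open>The polar body \<open>M\<close> is bounded because \<open>L\<close> contains a ball
  around \<open>0\<close>, so the ray leaves it. A point of \<open>M\<close> outside the open polar
  turns some inequality into an equality.\<close>

lemma open_polar_ray:
  assumes L: "compact L" and 0: "0 \<in> interior L" and p: "p \<in> open_polar L" and w: "w \<noteq> 0"
  obtains t where "0 < t" "p + t *\<^sub>R w \<in> polar_frontier L"
proof -
  define M where "M = {u. \<forall>y\<in>L. y \<bullet> u \<le> 1}"
  have "M = (\<Inter>y\<in>L. {u. y \<bullet> u \<le> 1})" by (auto simp: M_def)
  then have closed: "closed M" by (auto intro: closed_halfspace_le)
  obtain e where e: "e > 0" "cball 0 e \<subseteq> L"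
    using 0 by (meson mem_interior_cball)
  have "norm u \<le> 1 / e" if "u \<in> M" for u
  proof (cases "u = 0")
    case False
    have "(e / norm u) *\<^sub>R u \<in> L" using e False by (intro subsetD[OF e(2)]) simp
    then have "((e / norm u) *\<^sub>R u) \<bullet> u \<le> 1" using that unfolding M_def by blast
    moreover have "u \<bullet> u = norm u * norm u" by (simp add: dot_square_norm power2_eq_square)
    ultimately have "e * norm u \<le> 1" using False by simp
    then show ?thesis using e by (simp add: field_simps)
  qed (use e in simp)
  then have bounded: "bounded M" unfolding bounded_iff by blast
  have sub: "open_polar L \<subseteq> interior M"
    by (rule interior_maximal[OF _ open_open_polar[OF L]]) (auto simp: open_polar_def M_def)
  obtain d where d: "0 < d" "p + d *\<^sub>R w \<in> frontier M"
    using ray_to_frontier[OF bounded _ w] p sub by blast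
  have "p + d *\<^sub>R w \<in> M" "p + d *\<^sub>R w \<notin> open_polar L"
    using d(2) sub closed by (auto simp: frontier_def)
  then have "p + d *\<^sub>R w \<in> polar_frontier L"
    unfolding M_def open_polar_def polar_frontier_def by (auto intro: antisym simp: not_less)
  with d that show ?thesis by blast
qed

text \<open>In both directions the line from \<open>p\<close> along \<open>w\<close> reaches the
  polar boundary inside the hyperplanes dual to \<open>X\<close>; together with \<open>p\<close>
  this gives three zeros of \<open>q - r\<close>.\<close>

lemma quadratics_agree:
  assumes L: "compact L" "0 \<in> interior L" and p: "p \<in> open_polar L"
    and q: "quadratic q" "quadratic r" "q p = r p"
    and X: "\<And>x. x \<in> X \<Longrightarrow> x \<bullet> p = 1"
    and zero: "\<And>u. u \<in> polar_frontier L \<Longrightarrow> \<forall>x\<in>X. x \<bullet> u = 1 \<Longrightarrow> q u = 0 \<and> r u = 0"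
    and w: "\<And>x. x \<in> X \<Longrightarrow> x \<bullet> w = 0"
  shows "q (p + w) = r (p + w)"
proof (cases "w = 0")
  case False
  obtain s where s: "0 < s" "p + s *\<^sub>R w \<in> polar_frontier L"
    using open_polar_ray[OF L p False] by blast
  obtain t where t: "0 < t" "p + t *\<^sub>R (- w) \<in> polar_frontier L"
    using open_polar_ray[OF L p, of "- w"] False by auto
  have "q (p + s *\<^sub>R w) - r (p + s *\<^sub>R w) = 0" "q (p - t *\<^sub>R w) - r (p - t *\<^sub>R w) = 0"
    using zero[OF s(2)] zero[OF t(2)] X w by (auto simp: inner_add_right inner_diff_right)
  from quadratic_zero_on_line[OF quadratic_diff[OF q(1,2)] _ this s(1) t(1), of 1] q(3)
  show ?thesis by simp
qed (simp add: q)

section \<open>Boundary points in slices of a convex body\<close>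

lemma chord_not_collinear:
  fixes K :: "'a::euclidean_space set"
  assumes K: "convex K" "closed K" and abc: "a \<in> frontier K" "b \<in> frontier K" "c \<in> frontier K"
    and ne: "c \<noteq> a" "c \<noteq> b"
    and chord: "open_segment a b \<inter> interior K \<noteq> {}"
  shows "\<not> collinear {a, b, c}"
proof
  assume "collinear {a, b, c}"
  obtain m where m: "m \<in> open_segment a b" "m \<in> interior K" using chord by blast
  \<comment> \<open>Points strictly between an interior point and a frontier point are interior, so
    each side of \<open>m\<close> on the line carries at most one frontier point.\<close>
  have seg: "open_segment m x \<inter> frontier K = {}" if "x \<in> frontier K" for x
    using in_interior_closure_convex_segment[OF K(1) m(2), of x] that by (auto simp: frontier_def)
  obtain s where s: "0 < s" "s < 1" "m = (1 - s) *\<^sub>R a + s *\<^sub>R b" and ab: "a \<noteq> b"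
    using m(1) by (auto simp: in_segment)
  have mint: "m \<notin> frontier K" using m(2) by (simp add: frontier_def)
  from \<open>collinear {a, b, c}\<close> have "collinear {a, c, b}" by (simp add: insert_commute)
  then obtain u where "c = u *\<^sub>R a + (1 - u) *\<^sub>R b"
    using ab unfolding collinear_3_expand by blast
  then have r: "c = a + (1 - u) *\<^sub>R (b - a)" by (simp add: algebra_simps)
  define r where "r = 1 - u"
  note r = r[folded r_def]
  have meq: "m = a + s *\<^sub>R (b - a)" using s by (simp add: algebra_simps)
  have in_seg: "a + j *\<^sub>R (b - a) \<in> open_segment m (a + k *\<^sub>R (b - a))"
    if "s < j \<and> j < k \<or> k < j \<and> j < s" for j k
  proof -
    have "(s - k) *\<^sub>R (b - a) \<noteq> 0" using ab that by auto
    then have "m \<noteq> a + k *\<^sub>R (b - a)" by (simp add: meq scaleR_left_diff_distrib)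
    moreover have "a + j *\<^sub>R (b - a) = (1 - (j - s) / (k - s)) *\<^sub>R m + ((j - s) / (k - s)) *\<^sub>R (a + k *\<^sub>R (b - a))"
    proof -
      define i where "i = (j - s) / (k - s)"
      have "i * (k - s) = j - s" using that by (auto simp: i_def)
      moreover have "(1 - i) * s + i * k = s + i * (k - s)" by (simp add: algebra_simps)
      ultimately have "a + j *\<^sub>R (b - a) = a + ((1 - i) * s + i * k) *\<^sub>R (b - a)" by simp
      also have "\<dots> = (1 - i) *\<^sub>R m + i *\<^sub>R (a + k *\<^sub>R (b - a))"
        unfolding meq by (simp add: algebra_simps)
      finally show ?thesis by (simp only: i_def)
    qed
    moreover have "0 < (j - s) / (k - s)" "(j - s) / (k - s) < 1"
      using that by (auto simp: field_simps divide_less_0_iff zero_less_divide_iff)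
    ultimately show ?thesis unfolding in_segment by blast
  qed
  \<comment> \<open>\<open>r\<close> is the position of \<open>c\<close> on the line, with
    \<open>a\<close> at 0, \<open>m\<close> at \<open>s\<close> and \<open>b\<close> at 1. Each open
    range of \<open>r\<close> puts one of \<open>a\<close>, \<open>b\<close>, \<open>c\<close>
    strictly between \<open>m\<close> and another.\<close>
  consider "r = 0" | "r = 1" | "r = s" | "r < 0" | "0 < r \<and> r < s" | "s < r \<and> r < 1" | "1 < r"
    by linarith
  then show False
  proof cases
    case 4 with in_seg[of 0 r] seg[of c] abc r s show False by auto
  next
    case 5 with in_seg[of r 0] seg[of a] abc r s show False by auto
  next
    case 6 with in_seg[of r 1] seg[of b] abc r s show False by auto
  next
    case 7 with in_seg[of 1 r] seg[of c] abc r s show False by auto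
  qed (use r ne meq mint abc in auto)
qed

text \<open>On a hyperplane missing the origin, linear dependence is affine dependence: pairing with
  \<open>p\<close> forces the coefficients to sum to 1.\<close>

lemma collinear_if_in_span:
  assumes "a \<in> span {b, c}" "a \<bullet> p = 1" "b \<bullet> p = 1" "c \<bullet> p = 1"
  shows "collinear {a, b, c}"
proof -
  obtain s t where a: "a = s *\<^sub>R b + t *\<^sub>R c"
    using assms(1) by (metis (no_types, lifting) diff_add_cancel span_breakdown_eq span_empty singletonD add.commute add.right_neutral)
  then have "s + t = 1" using assms by (simp add: inner_add_left)
  then have "a = s *\<^sub>R b + (1 - s) *\<^sub>R c" using a by (metis add_diff_cancel_left')
  then have "collinear {b, a, c}" unfolding collinear_3_expand by blast
  then show ?thesis by (simp add: insert_commute)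
qed

text \<open>At the point \<open>x\<close> nearest to \<open>z\<close> the slice contains a ball touching its boundary, so a boundary
  segment ending at \<open>x\<close> is perpendicular to \<open>x - z\<close>.\<close>

lemma slice_chord:
  assumes K: "convex K" "closed K" "bounded K" and z: "z \<in> interior K" "z \<bullet> p = 1"
    and x: "x \<in> frontier K" "x \<bullet> p = 1"
    and nearest: "\<And>y. y \<in> frontier K \<Longrightarrow> y \<bullet> p = 1 \<Longrightarrow> dist z x \<le> dist z y"
    and y: "y \<in> frontier K" "y \<bullet> p = 1" "(y - z) \<bullet> (x - z) = 0"
  shows "open_segment x y \<inter> interior K \<noteq> {}"
proof -
  define r s where "r = (norm (x - z))\<^sup>2" and "s = (norm (y - z))\<^sup>2"
  have "x \<noteq> z" "y \<noteq> z" using x y z by (auto simp: frontier_def)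
  then have rs: "r > 0" "s > 0" by (auto simp: r_def s_def)
  \<comment> \<open>This makes \<open>m\<close> the foot of the perpendicular from \<open>z\<close>
    to the segment: in the right triangle with corner \<open>z\<close> it divides the hypotenuse in
    the ratio of the squared legs.\<close>
  define e where "e = r / (r + s)"
  have e: "0 < e" "e < 1" using rs by (auto simp: e_def field_simps)
  define m where "m = (1 - e) *\<^sub>R x + e *\<^sub>R y"
  have "x \<noteq> y" using y(3) rs by (auto simp: r_def)
  then have m: "m \<in> open_segment x y" using e by (auto simp: in_segment m_def)
  have "m - z = (1 - e) *\<^sub>R (x - z) + e *\<^sub>R (y - z)" by (simp add: m_def algebra_simps)
  moreover have "orthogonal ((1 - e) *\<^sub>R (x - z)) (e *\<^sub>R (y - z))"
    using y(3) by (simp add: orthogonal_def inner_commute)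
  ultimately have "(norm (m - z))\<^sup>2 = (1 - e)\<^sup>2 * r + e\<^sup>2 * s"
    by (simp add: norm_add_Pythagorean r_def s_def power_mult_distrib)
  also have "\<dots> = r - e * r"
  proof -
    have "(1 - e)\<^sup>2 * r + e\<^sup>2 * s = r - 2 * e * r + e * (e * (r + s))"
      by (simp add: power2_eq_square algebra_simps)
    moreover have "e * (r + s) = r" using rs by (simp add: e_def)
    ultimately show ?thesis by simp
  qed
  also have "\<dots> < r" using e rs by simp
  finally have lt: "dist z m < dist z x"
    by (simp add: r_def dist_norm norm_minus_commute power2_less_imp_less)
  have mp: "m \<bullet> p = 1" using x y by (simp add: m_def inner_add_left)
  have "m \<in> interior K"
  proof (rule ccontr)
    assume "m \<notin> interior K"
    then have "closed_segment z m \<inter> frontier (interior K) \<noteq> {}"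
      using z(1) by (intro connected_Int_frontier) auto
    then obtain y' where y': "y' \<in> closed_segment z m" "y' \<in> frontier K"
      using frontier_interior_subset by blast
    then obtain k where k: "y' = (1 - k) *\<^sub>R z + k *\<^sub>R m" by (auto simp: in_segment)
    have "y' \<bullet> p = 1" using z mp by (simp add: k inner_add_left)
    moreover have "dist z y' \<le> dist z m" using y'(1) by (simp add: segment_bound1 dist_norm norm_minus_commute segment_bound)
    ultimately show False using nearest[OF y'(2)] lt by linarith
  qed
  with m show ?thesis by blast
qed

text \<open>If no side of the triangle lies on the boundary, no further boundary point of the slice is
  collinear with two vertices; this nondegeneracy makes the gluing below work.\<close>

lemma slice_triangle:
  fixes K :: "'a::euclidean_space set"
  assumes dim: "3 \<le> DIM('a)" and K: "compact K" "convex K"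
    and z: "z \<in> interior K" "z \<bullet> p = 1"
  obtains a b c where
    "a \<in> frontier K" "b \<in> frontier K" "c \<in> frontier K" "a \<bullet> p = 1" "b \<bullet> p = 1" "c \<bullet> p = 1"
    "a \<noteq> b" "a \<noteq> c" "b \<noteq> c"
    "open_segment a b \<inter> interior K \<noteq> {}" "open_segment a c \<inter> interior K \<noteq> {}"
    "open_segment b c \<inter> interior K \<noteq> {}"
proof -
  have bd: "bounded K" "closed K" using K by (auto simp: compact_imp_bounded compact_imp_closed)
  define D where "D = frontier K \<inter> {y. y \<bullet> p = 1}"
  have "closed D" unfolding D_def
    by (intro closed_Int frontier_closed) (simp add: closed_hyperplane inner_commute[of _ p])
  moreover have "D \<noteq> {}"
  proof -
    obtain v where v: "v \<noteq> 0" "v \<bullet> p = 0" "v \<bullet> p = 0" using orthogonal_direction[OF dim, of p p] .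
    obtain d where "0 < d" "z + d *\<^sub>R v \<in> frontier K" using ray_to_frontier[OF bd(1) z(1) v(1)] .
    then have "z + d *\<^sub>R v \<in> D" using z(2) v(2) by (simp add: D_def inner_add_left)
    then show ?thesis by blast
  qed
  ultimately obtain a where a: "a \<in> D" "\<And>y. y \<in> D \<Longrightarrow> dist z a \<le> dist z y"
    using distance_attains_inf by blast
  txt \<open>The chord \<open>b c\<close> passes through \<open>z\<close>, perpendicularly to \<open>a - z\<close>.\<close>
  obtain v where v: "v \<noteq> 0" "v \<bullet> p = 0" "v \<bullet> (a - z) = 0"
    using orthogonal_direction[OF dim] .
  obtain s where s: "0 < s" "z + s *\<^sub>R v \<in> frontier K"
    using ray_to_frontier[OF bd(1) z(1) v(1)] by blast
  obtain t where t: "0 < t" "z + t *\<^sub>R (- v) \<in> frontier K"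
    using ray_to_frontier[OF bd(1) z(1), of "- v"] v(1) by auto
  define b c where "b = z + s *\<^sub>R v" and "c = z - t *\<^sub>R v"
  have bc: "b \<in> frontier K" "c \<in> frontier K" "b \<bullet> p = 1" "c \<bullet> p = 1"
    "(b - z) \<bullet> (a - z) = 0" "(c - z) \<bullet> (a - z) = 0"
    using s t v z by (auto simp: b_def c_def inner_add_left inner_diff_left)
  have a': "a \<in> frontier K" "a \<bullet> p = 1" using a by (auto simp: D_def)
  have near: "dist z a \<le> dist z y" if "y \<in> frontier K" "y \<bullet> p = 1" for y
    using a(2) that by (simp add: D_def)
  have chords: "open_segment a b \<inter> interior K \<noteq> {}" "open_segment a c \<inter> interior K \<noteq> {}"
    using slice_chord[OF K(2) bd(2,1) z a' near] bc by auto
  have "b - c = (s + t) *\<^sub>R v" by (simp add: b_def c_def algebra_simps)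
  then have "b \<noteq> c" using s t v by auto
  moreover have "z \<in> open_segment b c"
  proof -
    have "(1 - s / (s + t)) *\<^sub>R b + (s / (s + t)) *\<^sub>R c
        = z + ((1 - s / (s + t)) * s - s / (s + t) * t) *\<^sub>R v"
      by (simp add: b_def c_def algebra_simps)
    moreover have "(1 - s / (s + t)) * s - s / (s + t) * t = 0" using s t by (simp add: field_simps)
    ultimately have "z = (1 - s / (s + t)) *\<^sub>R b + (s / (s + t)) *\<^sub>R c" by simp
    moreover have "0 < s / (s + t)" "s / (s + t) < 1" using s t by auto
    ultimately show ?thesis using \<open>b \<noteq> c\<close> unfolding in_segment by blast
  qed
  moreover have "a \<noteq> b" "a \<noteq> c" using chords by auto
  ultimately show ?thesis using that[of a b c] a' bc chords z(1) by blast
qed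

section \<open>Gluing the sections\<close>

text \<open>\<open>section_quadratic\<close> is the graze hypothesis after dualising. The value -1
  at \<open>p\<close> fixes the scale, so that quadrics of different sections can be compared along
  lines through \<open>p\<close>.\<close>

locale quadratic_sections =
  fixes K L :: "'a::euclidean_space set"
  assumes dim: "3 \<le> DIM('a)"
    and K: "compact K" "convex K"
    and L: "compact L" "convex L" "0 \<in> interior L" "L \<subseteq> interior K"
    and section_quadratic: "\<And>x p. x \<in> frontier K \<Longrightarrow> p \<in> open_polar L \<Longrightarrow>
      \<exists>q. quadratic q \<and> q p = - 1 \<and> (\<forall>u\<in>polar_frontier L. x \<bullet> u = 1 \<longrightarrow> q u = 0)"
begin

text \<open>\<open>fits p q\<close>: the quadric \<open>q = 0\<close> contains all the sections through \<open>p\<close>.\<close>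

definition fits :: "'a \<Rightarrow> ('a \<Rightarrow> real) \<Rightarrow> bool" where
  "fits p q \<longleftrightarrow> quadratic q \<and> q p = - 1 \<and>
     (\<forall>x\<in>frontier K. x \<bullet> p = 1 \<longrightarrow> (\<forall>u\<in>polar_frontier L. x \<bullet> u = 1 \<longrightarrow> q u = 0))"

lemma fits_exists:
  assumes p: "p \<in> open_polar L" and z: "z \<in> interior K" "z \<bullet> p = 1"
  shows "\<exists>q. fits p q"
proof -
  obtain a b c where abc: "a \<in> frontier K" "b \<in> frontier K" "c \<in> frontier K"
      "a \<bullet> p = 1" "b \<bullet> p = 1" "c \<bullet> p = 1" "a \<noteq> b" "a \<noteq> c" "b \<noteq> c"
    and chords: "open_segment a b \<inter> interior K \<noteq> {}" "open_segment a c \<inter> interior K \<noteq> {}"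
      "open_segment b c \<inter> interior K \<noteq> {}"
    using slice_triangle[OF dim K z] by blast
  \<comment> \<open>Three boundary points of the slice are linearly independent if two of them span
    a chord through the interior.\<close>
  have ns: "w \<notin> span {x, y}" "x \<notin> span {w, y}" "y \<notin> span {w, x}"
    if "x \<in> frontier K" "y \<in> frontier K" "w \<in> frontier K"
      "x \<bullet> p = 1" "y \<bullet> p = 1" "w \<bullet> p = 1" "w \<noteq> x" "w \<noteq> y"
      "open_segment x y \<inter> interior K \<noteq> {}" for x y w
  proof -
    have "\<not> collinear {x, y, w}"
      by (rule chord_not_collinear[OF K(2) compact_imp_closed[OF K(1)] that(1-3,7-9)])
    moreover have "{w, x, y} = {x, y, w}" "{x, w, y} = {x, y, w}" "{y, w, x} = {x, y, w}" by auto
    ultimately show "w \<notin> span {x, y}" "x \<notin> span {w, y}" "y \<notin> span {w, x}"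
      using collinear_if_in_span[of w x y p] collinear_if_in_span[of x w y p]
        collinear_if_in_span[of y w x p] that(4-6) by metis+
  qed
  obtain Q where Q: "\<And>x. x \<in> frontier K \<Longrightarrow> quadratic (Q x)" "\<And>x. x \<in> frontier K \<Longrightarrow> Q x p = - 1"
    "\<And>x u. x \<in> frontier K \<Longrightarrow> u \<in> polar_frontier L \<Longrightarrow> x \<bullet> u = 1 \<Longrightarrow> Q x u = 0"
  proof -
    have "\<forall>x. \<exists>q. x \<in> frontier K \<longrightarrow>
        quadratic q \<and> q p = - 1 \<and> (\<forall>u\<in>polar_frontier L. x \<bullet> u = 1 \<longrightarrow> q u = 0)"
      using section_quadratic[OF _ p] by blast
    from choice[OF this] obtain Q where "\<forall>x. x \<in> frontier K \<longrightarrow>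
        quadratic (Q x) \<and> Q x p = - 1 \<and> (\<forall>u\<in>polar_frontier L. x \<bullet> u = 1 \<longrightarrow> Q x u = 0)" ..
    then show ?thesis by (intro that[of Q]) auto
  qed
  have agree: "Q x (p + w) = Q y (p + w)"
    if "x \<in> frontier K" "y \<in> frontier K" "x \<bullet> p = 1" "y \<bullet> p = 1" "x \<bullet> w = 0" "y \<bullet> w = 0" for x y w
    by (rule quadratics_agree[OF L(1,3) p, of "Q x" "Q y" "{x, y}" w]) (use Q that in simp_all, (elim disjE; simp)+)
  obtain q where q: "quadratic q" "\<And>w. a \<bullet> w = 0 \<Longrightarrow> q (p + w) = Q a (p + w)"
    "\<And>w. b \<bullet> w = 0 \<Longrightarrow> q (p + w) = Q b (p + w)" "\<And>w. c \<bullet> w = 0 \<Longrightarrow> q (p + w) = Q c (p + w)"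
  proof (rule quadratic_glue3[OF Q(1)[OF abc(1)] Q(1)[OF abc(2)] Q(1)[OF abc(3)], of a b p c])
    show "a \<notin> span {b, c}" "b \<notin> span {a, c}"
      using ns(1)[of b c a] ns(1)[of a c b] abc chords by simp_all
  qed (use agree abc in blast)+
  have "q u = 0" if x: "x \<in> frontier K" "x \<bullet> p = 1" and u: "u \<in> polar_frontier L" "x \<bullet> u = 1" for x u
  proof -
    have xw: "x \<bullet> (u - p) = 0" using x u by (simp add: inner_diff_right)
    have "q (p + (u - p)) = Q x (p + (u - p))"
    proof (cases "x \<in> {a, b, c}")
      case True
      then show ?thesis using q(2)[of "u - p"] q(3)[of "u - p"] q(4)[of "u - p"] xw by auto
    next
      case False
      then have x': "x \<noteq> a" "x \<noteq> b" "x \<noteq> c" by auto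
      \<comment> \<open>On the hyperplane orthogonal to \<open>x\<close>, the difference
        \<open>q - Q x\<close> vanishes on the kernels of \<open>a\<close>, \<open>b\<close> and
        \<open>c\<close>. The first two give a factorization, \<open>e\<close> showing that they
        differ there; a vector \<open>f\<close> in the kernel of \<open>c\<close> but in neither of
        the others kills the constant.\<close>
      obtain e where e: "x \<bullet> e = 0" "b \<bullet> e = 0" "a \<bullet> e \<noteq> 0"
        by (rule orthogonal_complement_separates[of a "{x, b}"])
          (use ns(2)[OF abc(1,2) x(1) abc(4,5) x(2) x'(1,2) chords(1)] in auto)
      obtain f1 where f1: "x \<bullet> f1 = 0" "c \<bullet> f1 = 0" "a \<bullet> f1 \<noteq> 0"
        by (rule orthogonal_complement_separates[of a "{x, c}"])
          (use ns(2)[OF abc(1,3) x(1) abc(4,6) x(2) x'(1,3) chords(2)] in auto)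
      obtain f2 where f2: "x \<bullet> f2 = 0" "c \<bullet> f2 = 0" "b \<bullet> f2 \<noteq> 0"
        by (rule orthogonal_complement_separates[of b "{x, c}"])
          (use ns(2)[OF abc(2,3) x(1) abc(5,6) x(2) x'(2,3) chords(3)] in auto)
      \<comment> \<open>If neither \<open>f1\<close> nor \<open>f2\<close> avoids both kernels,
        their sum does.\<close>
      obtain f where f: "x \<bullet> f = 0" "c \<bullet> f = 0" "a \<bullet> f \<noteq> 0" "b \<bullet> f \<noteq> 0"
      proof -
        consider "b \<bullet> f1 \<noteq> 0" | "a \<bullet> f2 \<noteq> 0" | "b \<bullet> f1 = 0" "a \<bullet> f2 = 0" by blast
        then show ?thesis
        proof cases
          case 3
          then show ?thesis using f1 f2 by (intro that[of "f1 + f2"]) (auto simp: inner_add_right)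
        qed (use f1 f2 that in blast)+
      qed
      have W: "subspace {w. x \<bullet> w = 0}" by (rule subspace_hyperplane)
      have zero: "q (p + w) - Q x (p + w) = 0"
        if "w \<in> {w. x \<bullet> w = 0}" "a \<bullet> w = 0 \<or> b \<bullet> w = 0 \<or> c \<bullet> w = 0" for w
        using that q agree[of a x w] agree[of b x w] agree[of c x w] abc x by auto
      have "q (p + (u - p)) - Q x (p + (u - p)) = 0"
        by (rule quadratic_zero_of_factor[OF quadratic_diff[OF q(1) Q(1)[OF x(1)]] W, of a b p e f])
          (use zero e f xw in auto)
      then show ?thesis by simp
    qed
    then show ?thesis using Q(3)[OF x(1) u] by simp
  qed
  moreover have "q p = - 1" using q(2)[of 0] Q(2)[OF abc(1)] by simp
  ultimately show ?thesis using q(1) by (auto simp: fits_def)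
qed

lemma frontier_ray:
  assumes "z \<in> interior K" "v \<noteq> 0"
  obtains d where "0 < d" "z + d *\<^sub>R v \<in> frontier K"
  using ray_to_frontier[OF compact_imp_bounded[OF K(1)] assms] by blast

text \<open>Moving \<open>z\<close> to the frontier of \<open>K\<close> in a direction orthogonal to
  \<open>p\<close> and \<open>u\<close> keeps both equations, so interior points serve as well as
  frontier points.\<close>

lemma fits_zero:
  assumes "fits p q" "u \<in> polar_frontier L" "z \<in> interior K" "z \<bullet> p = 1" "z \<bullet> u = 1"
  shows "q u = 0"
proof -
  obtain v where v: "v \<noteq> 0" "v \<bullet> p = 0" "v \<bullet> u = 0" using orthogonal_direction[OF dim] .
  obtain d where "0 < d" "z + d *\<^sub>R v \<in> frontier K" using frontier_ray[OF assms(3) v(1)] .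
  then show ?thesis using assms v by (auto simp: fits_def inner_add_left)
qed

lemma fits_proportional:
  assumes p: "p \<in> open_polar L" and fit: "fits p q" "fits p' q'"
    and z: "z \<in> interior K" "z \<bullet> p = 1" "z \<bullet> p' = 1"
  shows "\<exists>k. k \<noteq> 0 \<and> (\<forall>u. q' u = k * q u)"
proof -
  have quad: "quadratic q" "quadratic q'" and qp: "q p = - 1" "q' p' = - 1"
    using fit by (auto simp: fits_def)
  obtain v where v: "v \<noteq> 0" "v \<bullet> p = 0" "v \<bullet> p' = 0" using orthogonal_direction[OF dim] .
  obtain s where s: "0 < s" "z + s *\<^sub>R v \<in> frontier K" using frontier_ray[OF z(1) v(1)] .
  obtain t where t: "0 < t" "z + t *\<^sub>R (- v) \<in> frontier K"
    using frontier_ray[OF z(1), of "- v"] v(1) by auto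
  define a b where "a = z + s *\<^sub>R v" and "b = z - t *\<^sub>R v"
  have ab: "a \<in> frontier K" "b \<in> frontier K" "a \<bullet> p = 1" "a \<bullet> p' = 1" "b \<bullet> p = 1" "b \<bullet> p' = 1"
    using s t v z by (auto simp: a_def b_def inner_add_left inner_diff_left)
  txt \<open>The sections dual to \<open>a\<close> and \<open>b\<close> are common to both quadrics. They leave one parameter,
    which a boundary point \<open>p + r w\<close> off these two sections fixes: \<open>z\<close> lies on its dual hyperplane too.\<close>
  define w where "w = v - ((v \<bullet> z) / (z \<bullet> z)) *\<^sub>R z"
  have z0: "z \<noteq> 0" using z by auto
  \<comment> \<open>\<open>w\<close> is the part of \<open>v\<close> orthogonal to \<open>z\<close>.
    It is nonzero because \<open>v\<close> is orthogonal to \<open>p\<close>, while nonzero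
    multiples of \<open>z\<close> are not.\<close>
  have zw: "z \<bullet> w = 0" using z0 by (simp add: w_def inner_diff_right inner_commute)
  have w0: "w \<noteq> 0"
  proof
    assume "w = 0"
    then have veq: "v = ((v \<bullet> z) / (z \<bullet> z)) *\<^sub>R z" by (simp add: w_def)
    from arg_cong[OF this, of "\<lambda>x. x \<bullet> p"] have "(v \<bullet> z) / (z \<bullet> z) = 0" using z(2) v(2) by simp
    with veq v(1) show False by (metis scaleR_zero_left)
  qed
  have "v = w + ((v \<bullet> z) / (z \<bullet> z)) *\<^sub>R z" by (simp add: w_def)
  then have "v \<bullet> w = w \<bullet> w" using zw by (metis add.right_neutral inner_add_left inner_scaleR_left mult_zero_right)
  then have vw: "v \<bullet> w > 0" using w0 by simp
  obtain r where r: "0 < r" "p + r *\<^sub>R w \<in> polar_frontier L"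
    using open_polar_ray[OF L(1,3) p w0] .
  have zr: "z \<bullet> (p + r *\<^sub>R w) = 1" using z zw by (simp add: inner_add_right)
  define e where "e = w - (b \<bullet> w) *\<^sub>R p"
  have aw: "a \<bullet> w = s * (v \<bullet> w)" and bw: "b \<bullet> w = - t * (v \<bullet> w)"
    using zw by (auto simp: a_def b_def inner_add_left inner_diff_left)
  have "a \<bullet> e = (s + t) * (v \<bullet> w)"
    using ab aw bw by (simp add: e_def inner_diff_right algebra_simps)
  then have ae: "a \<bullet> e \<noteq> 0" and be: "b \<bullet> e = 0"
    using s t vw ab by (simp_all add: e_def inner_diff_right)
  \<comment> \<open>Since \<open>q p = - 1\<close>, this factor makes \<open>q'\<close> and
    \<open>k * q\<close> agree at \<open>p\<close>, as comparison along lines through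
    \<open>p\<close> requires.\<close>
  define k where "k = - q' p"
  have zero: "q' (p + w) - k * q (p + w) = 0" if "x \<in> {a, b}" "x \<bullet> w = 0" for x w
  proof -
    have "q' (p + w) = k * q (p + w)"
      by (rule quadratics_agree[OF L(1,3) p quad(2) quadratic_cmult[OF quad(1)], of k "{x}"])
        (use that ab fit qp in \<open>auto simp: k_def fits_def\<close>)
    then show ?thesis by simp
  qed
  have "q' (p + x) - k * q (p + x) = 0" for x
    by (rule quadratic_zero_of_factor[OF quadratic_diff[OF quad(2) quadratic_cmult[OF quad(1)]]
          subspace_UNIV, of a b p k e "r *\<^sub>R w" x])
      (use zero ae be aw bw s t r vw fits_zero[OF fit(1) r(2) z(1,2) zr]
        fits_zero[OF fit(2) r(2) z(1,3) zr] in auto)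
  from this[of "_ - p"] have eq: "q' u = k * q u" for u by simp
  then have "k \<noteq> 0" using qp(2) by auto
  with eq show ?thesis by blast
qed

section \<open>Comparing the quadrics of different points\<close>

lemma open_polar_witness:
  assumes "z \<notin> L"
  obtains p where "p \<in> open_polar L" "z \<bullet> p = 1"
proof -
  \<comment> \<open>The separating functional is negative at \<open>z\<close> because
    \<open>0\<close> lies in \<open>L\<close>; dividing it by that value gives the required
    \<open>p\<close>.\<close>
  obtain a b where ab: "a \<bullet> z < b" "\<forall>x\<in>L. b < a \<bullet> x"
    using separating_hyperplane_closed_point[OF L(2) compact_imp_closed[OF L(1)] assms] by blast
  have "0 \<in> L" using L(3) interior_subset by blast
  then have "b < 0" using ab by force
  then have neg: "a \<bullet> z < 0" using ab by simp
  have "y \<bullet> ((1 / (a \<bullet> z)) *\<^sub>R a) < 1" if "y \<in> L" for y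
    using ab neg that by (force simp: inner_commute[of y] divide_less_eq)
  then show ?thesis
    using neg that[of "(1 / (a \<bullet> z)) *\<^sub>R a"] by (auto simp: open_polar_def inner_commute[of z])
qed

text \<open>Quantifying over all fitting quadrics avoids choosing one for each point. The relation
  is vacuous where nothing fits, so transitivity asks for a middle point in
  \<open>interior K - L\<close>, where a fitting quadric exists.\<close>

definition related :: "'a \<Rightarrow> 'a \<Rightarrow> bool" where
  "related z z' \<longleftrightarrow> (\<forall>p\<in>open_polar L. \<forall>p'\<in>open_polar L. \<forall>q q'.
     z \<bullet> p = 1 \<longrightarrow> z' \<bullet> p' = 1 \<longrightarrow> fits p q \<longrightarrow> fits p' q' \<longrightarrow> (\<exists>k. k \<noteq> 0 \<and> (\<forall>u. q' u = k * q u)))"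

lemma related_sym:
  assumes "related z z'"
  shows "related z' z"
  unfolding related_def
proof (intro ballI allI impI)
  fix p p' q q' assume "p \<in> open_polar L" "p' \<in> open_polar L" "z' \<bullet> p = 1" "z \<bullet> p' = 1" "fits p q" "fits p' q'"
  then obtain k where "k \<noteq> 0" "\<forall>u. q u = k * q' u" using assms unfolding related_def by blast
  then show "\<exists>k. k \<noteq> 0 \<and> (\<forall>u. q' u = k * q u)" by (intro exI[of _ "1 / k"]) simp
qed

lemma related_trans:
  assumes "related x y" "related y z" "y \<in> interior K - L"
  shows "related x z"
  unfolding related_def
proof (intro ballI allI impI)
  fix p p' q q' assume *: "p \<in> open_polar L" "p' \<in> open_polar L" "x \<bullet> p = 1" "z \<bullet> p' = 1" "fits p q" "fits p' q'"
  obtain r where r: "r \<in> open_polar L" "y \<bullet> r = 1" using open_polar_witness assms(3) by blast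
  obtain g where g: "fits r g" using fits_exists[OF r(1)] r assms(3) by blast
  obtain k where k: "k \<noteq> 0" "\<forall>u. g u = k * q u"
    using assms(1) * r g unfolding related_def by blast
  obtain l where l: "l \<noteq> 0" "\<forall>u. q' u = l * g u"
    using assms(2) * r g unfolding related_def by blast
  show "\<exists>k. k \<noteq> 0 \<and> (\<forall>u. q' u = k * q u)"
    using k l by (intro exI[of _ "l * k"]) simp
qed

text \<open>A quadric fitting the common \<open>p\<close> is the intermediary: it is proportional to
  those of \<open>z\<close> and to those of \<open>z'\<close>.\<close>

lemma related_if_common:
  assumes "p \<in> open_polar L" "z \<bullet> p = 1" "z' \<bullet> p = 1" "z \<in> interior K" "z' \<in> interior K"
  shows "related z z'"
  unfolding related_def
proof (intro ballI allI impI)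
  fix r r' q q' assume *: "r \<in> open_polar L" "r' \<in> open_polar L" "z \<bullet> r = 1" "z' \<bullet> r' = 1" "fits r q" "fits r' q'"
  obtain g where g: "fits p g" using fits_exists[OF assms(1,4,2)] by blast
  obtain k where k: "k \<noteq> 0" "\<forall>u. g u = k * q u"
    using fits_proportional[OF *(1,5) g assms(4)] * assms by blast
  obtain l where l: "l \<noteq> 0" "\<forall>u. q' u = l * g u"
    using fits_proportional[OF assms(1) g *(6) assms(5)] * assms by blast
  show "\<exists>k. k \<noteq> 0 \<and> (\<forall>u. q' u = k * q u)"
    using k l by (intro exI[of _ "l * k"]) simp
qed

lemma related_near:
  assumes z: "z \<in> interior K - L"
  obtains U where "open U" "z \<in> U" "\<And>z'. z' \<in> U \<inter> (interior K - L) \<Longrightarrow> related z z'"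
proof -
  obtain p where p: "p \<in> open_polar L" "z \<bullet> p = 1" using open_polar_witness z by blast
  obtain v where v: "v \<noteq> 0" "v \<bullet> p = 0" "v \<bullet> z = 0" using orthogonal_direction[OF dim] .
  txt \<open>Nearby points \<open>z\<close> and \<open>z'\<close> may span a line through \<open>L\<close>, so they are linked through a third
    point \<open>z + e v\<close> on a hyperplane through \<open>z\<close> that misses \<open>L\<close>.\<close>
  have "\<forall>\<^sub>F e in at_right 0. z + e *\<^sub>R v \<in> interior K"
  proof -
    have "((\<lambda>e. z + e *\<^sub>R v) \<longlongrightarrow> z + 0 *\<^sub>R v) (at_right 0)" by (intro tendsto_intros)
    then show ?thesis using z by (auto dest: topological_tendstoD[OF _ open_interior])
  qed
  then have "\<forall>\<^sub>F e in at_right 0. 0 < e \<and> z + e *\<^sub>R v \<in> interior K"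
    by (intro eventually_conj eventually_at_right_less)
  then obtain e where e: "0 < e" "z + e *\<^sub>R v \<in> interior K"
    using eventually_happens'[OF trivial_limit_at_right_real] by blast
  \<comment> \<open>\<open>w\<close> is orthogonal to \<open>z + e v\<close> but not to
    \<open>z\<close>. For \<open>z'\<close> near \<open>z\<close>, tilting \<open>p\<close> along
    \<open>w\<close> gives a dual hyperplane, that of \<open>F z'\<close>, through both
    \<open>z'\<close> and \<open>z + e v\<close>. It misses \<open>L\<close> because
    \<open>F z = p\<close> and the open polar is open.\<close>
  define w where "w = z - ((z \<bullet> z) / (e * (v \<bullet> v))) *\<^sub>R v"
  have "z \<noteq> 0" using p by auto
  then have zw: "z \<bullet> w \<noteq> 0" using v by (simp add: w_def inner_diff_right inner_commute)
  have xw: "(z + e *\<^sub>R v) \<bullet> w = 0"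
    using v e by (simp add: w_def inner_diff_right inner_add_left inner_commute[of z v])
  define F where "F z' = p + ((1 - z' \<bullet> p) / (z' \<bullet> w)) *\<^sub>R w" for z'
  have "(F \<longlongrightarrow> F z) (nhds z)"
    unfolding F_def using zw
    by (intro tendsto_intros) (auto intro!: tendsto_intros simp: tendsto_ident_at filterlim_ident)
  moreover have "F z = p" using p by (simp add: F_def)
  ultimately have "\<forall>\<^sub>F z' in nhds z. F z' \<in> open_polar L"
    using p by (auto dest: topological_tendstoD[OF _ open_open_polar[OF L(1)]])
  moreover have "((\<lambda>z'. z' \<bullet> w) \<longlongrightarrow> z \<bullet> w) (nhds z)"
    by (intro tendsto_intros filterlim_ident)
  then have "\<forall>\<^sub>F z' in nhds z. z' \<bullet> w \<noteq> 0"
    using zw by (rule tendsto_imp_eventually_ne)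
  ultimately have "\<forall>\<^sub>F z' in nhds z. F z' \<in> open_polar L \<and> z' \<bullet> w \<noteq> 0"
    by (rule eventually_conj)
  then obtain U where U: "open U" "z \<in> U" "\<And>z'. z' \<in> U \<Longrightarrow> F z' \<in> open_polar L \<and> z' \<bullet> w \<noteq> 0"
    unfolding eventually_nhds by blast
  have "related z z'" if z': "z' \<in> U \<inter> (interior K - L)" for z'
  proof -
    have zF: "z' \<bullet> F z' = 1" "(z + e *\<^sub>R v) \<bullet> F z' = 1"
      using U(3) z' xw p v by (auto simp: F_def inner_add_right inner_add_left[of z _ p])
    have xp: "(z + e *\<^sub>R v) \<bullet> p = 1" using p v by (simp add: inner_add_left)
    have "related z (z + e *\<^sub>R v)" using related_if_common[OF p xp] z e by blast
    moreover have "related (z + e *\<^sub>R v) z'" using related_if_common[OF _ zF(2,1)] U z' e by blast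
    moreover have "z + e *\<^sub>R v \<in> interior K - L" using xp p e by (auto simp: open_polar_def)
    ultimately show ?thesis by (rule related_trans)
  qed
  with U that show ?thesis by blast
qed

theorem polar_frontier_quadric:
  obtains q p where "quadratic q" "q p \<noteq> 0" "\<And>u. u \<in> polar_frontier L \<Longrightarrow> q u = 0"
proof -
  obtain e where e: "e > 0" "(\<Union>x\<in>L. cball x e) \<subseteq> interior K"
    using compact_subset_open_imp_cball_epsilon_subset[OF L(1) open_interior L(4)] by blast
  \<comment> \<open>\<open>M\<close> is an outer parallel body of \<open>L\<close> inside
    \<open>interior K\<close>. Its frontier is connected and lies in \<open>interior K - L\<close>,
    where fitting quadrics exist.\<close>
  define M where "M = {x + y | x y. x \<in> L \<and> y \<in> cball 0 e}"
  have "M = (\<Union>x\<in>L. \<Union>y\<in>cball 0 e. {x + y})" unfolding M_def by blast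
  then have M: "compact M" "convex M"
    using compact_sums[OF L(1) compact_cball, of 0 e] convex_sums[OF L(2) convex_cball, of 0 e]
    by (simp_all only: M_def)
  have MK: "M \<subseteq> interior K"
  proof
    fix m assume "m \<in> M"
    then obtain x y where "m = x + y" "x \<in> L" "norm y \<le> e" by (auto simp: M_def)
    then have "m \<in> cball x e" by (simp add: dist_norm)
    with e \<open>x \<in> L\<close> show "m \<in> interior K" by blast
  qed
  have LM: "L \<subseteq> interior M"
  proof
    fix x assume x: "x \<in> L"
    have "x' \<in> M" if "x' \<in> ball x e" for x'
    proof -
      have "x' = x + (x' - x)" "x' - x \<in> cball 0 e"
        using that by (auto simp: dist_norm norm_minus_commute)
      with x show ?thesis unfolding M_def by blast
    qed
    then show "x \<in> interior M" using e by (auto simp: mem_interior)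
  qed
  define T where "T = frontier M"
  have Tsub: "T \<subseteq> interior K - L"
    using MK LM compact_imp_closed[OF M(1)] by (auto simp: T_def frontier_def)
  have intM: "interior M \<noteq> {}" using LM L(3) interior_subset by blast
  have "connected T"
    using connected_sphere_gen[OF M(2) compact_imp_bounded[OF M(1)]] dim
      aff_dim_nonempty_interior[OF intM] rel_frontier_nonempty_interior[OF intM]
    by (simp add: T_def)
  then have rel: "related y z" if "y \<in> T" "z \<in> T" for y z
  proof (rule connected_equivalence_relation[of T y z related])
    fix a assume a: "a \<in> T"
    then obtain U where "open U" "a \<in> U" "\<And>z'. z' \<in> U \<inter> (interior K - L) \<Longrightarrow> related a z'"
      using related_near Tsub by blast
    then show "\<exists>V. openin (top_of_set T) V \<and> a \<in> V \<and> (\<forall>x\<in>V. related a x)"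
      using a Tsub by (intro exI[of _ "T \<inter> U"]) auto
  qed (use that related_sym related_trans Tsub in blast)+
  \<comment> \<open>The supporting hyperplane touches \<open>L\<close> at a point interior to
    \<open>M\<close>; moving within the hyperplane reaches \<open>T\<close>.\<close>
  have slice: "\<exists>z\<in>T. z \<bullet> u = 1" if u: "u \<in> polar_frontier L" for u
  proof -
    obtain y where y: "y \<in> L" "y \<bullet> u = 1" using u unfolding polar_frontier_def by blast
    have "y \<in> interior M" using y LM by blast
    obtain v where v: "v \<noteq> 0" "v \<bullet> u = 0" "v \<bullet> u = 0" using orthogonal_direction[OF dim, of u u] .
    obtain d where "0 < d" "y + d *\<^sub>R v \<in> T"
      using ray_to_frontier[OF compact_imp_bounded[OF M(1)] \<open>y \<in> interior M\<close> v(1)]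
      unfolding T_def .
    then show ?thesis using y v by (intro bexI) (auto simp: inner_add_left)
  qed
  have fit: "\<exists>p q. p \<in> open_polar L \<and> z \<bullet> p = 1 \<and> fits p q" if "z \<in> T" for z
  proof -
    have z: "z \<in> interior K" "z \<notin> L" using that Tsub by auto
    obtain p where "p \<in> open_polar L" "z \<bullet> p = 1" using open_polar_witness[OF z(2)] .
    then show ?thesis using fits_exists z(1) by blast
  qed
  have "0 \<in> open_polar L" by (simp add: open_polar_def)
  moreover obtain b :: 'a where "b \<in> Basis" using nonempty_Basis by blast
  ultimately obtain t where "0 < t" "0 + t *\<^sub>R b \<in> polar_frontier L"
    using open_polar_ray[OF L(1,3) _ nonzero_Basis] by metis
  then obtain z0 where z0: "z0 \<in> T" using slice by blast
  obtain p q where p: "p \<in> open_polar L" "z0 \<bullet> p = 1" and q: "fits p q" using fit[OF z0] by blast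
  have "q u = 0" if u: "u \<in> polar_frontier L" for u
  proof -
    obtain z where z: "z \<in> T" "z \<bullet> u = 1" using slice[OF u] by blast
    obtain p' q' where p': "p' \<in> open_polar L" "z \<bullet> p' = 1" and q': "fits p' q'" using fit[OF z(1)] by blast
    have "q' u = 0" using fits_zero[OF q' u _ p'(2) z(2)] z Tsub by blast
    moreover obtain k where "k \<noteq> 0" "\<forall>u. q' u = k * q u"
      using rel[OF z0 z(1)] p p' q q' unfolding related_def by blast
    ultimately show ?thesis by simp
  qed
  moreover have "quadratic q" "q p \<noteq> 0" using q by (auto simp: fits_def)
  ultimately show ?thesis using that by blast
qed

end

section \<open>From the polar quadric to the ellipsoid\<close>

text \<open>The form is evaluated at combinations of \<open>b\<close> and \<open>u\<close>. It may
  be degenerate: if \<open>R b b = 0\<close>, the coefficient \<open>- (R u u + 1)\<close> makes the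
  cross term outweigh the remaining square.\<close>

lemma psd_Cauchy_Schwarz:
  fixes R :: "'a::real_vector \<Rightarrow> 'a \<Rightarrow> real"
  assumes R: "bilinear R" and sym: "\<And>u v. R u v = R v u" and psd: "\<And>u. 0 \<le> R u u"
  shows "(R b u)\<^sup>2 \<le> R b b * R u u"
proof -
  have *: "0 \<le> x\<^sup>2 * R b b + 2 * x * y * R b u + y\<^sup>2 * R u u" for x y
    using psd[of "x *\<^sub>R b + y *\<^sub>R u"]
    by (simp add: bilinear_ladd[OF R] bilinear_radd[OF R] bilinear_lmul[OF R] bilinear_rmul[OF R]
        sym[of u b] power2_eq_square algebra_simps)
  show ?thesis
  proof (cases "R b b = 0")
    case True
    have "0 \<le> - ((R b u)\<^sup>2 * (R u u + 2))"
      using *[of "- (R u u + 1)" "R b u"] True by (simp add: power2_eq_square algebra_simps)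
    moreover have "R u u + 2 > 0" using psd[of u] by simp
    ultimately have "(R b u)\<^sup>2 \<le> 0" by (simp add: mult_le_0_iff)
    then show ?thesis using True by simp
  next
    case False
    then have pos: "R b b > 0" using psd[of b] by simp
    have "0 \<le> R b b * (R b b * R u u - (R b u)\<^sup>2)"
      using *[of "- R b u" "R b b"] by (simp add: power2_eq_square algebra_simps)
    then show ?thesis using pos by (simp add: zero_le_mult_iff)
  qed
qed

lemma psd_factor:
  fixes D :: "'a::euclidean_space \<Rightarrow> 'a \<Rightarrow> real"
  assumes D: "bilinear D" and symD: "\<And>u v. D u v = D v u" and psdD: "\<And>u. 0 \<le> D u u"
  obtains g :: "'a \<Rightarrow> 'a" where "linear g" "\<And>u. D u u = (norm (g u))\<^sup>2"
proof -
  txt \<open>Cholesky decomposition: split off one square for each basis vector.\<close>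
  define split where "split F \<phi> R \<longleftrightarrow> (\<forall>b\<in>F. linear (\<phi> b)) \<and> bilinear R \<and> (\<forall>u v. R u v = R v u) \<and>
      (\<forall>u. 0 \<le> R u u) \<and> (\<forall>b\<in>F. \<forall>u. R b u = 0) \<and> (\<forall>u. D u u = R u u + (\<Sum>b\<in>F. (\<phi> b u)\<^sup>2))"
    for F and \<phi> :: "'a \<Rightarrow> 'a \<Rightarrow> real" and R :: "'a \<Rightarrow> 'a \<Rightarrow> real"
  \<comment> \<open>The remainder \<open>R\<close> stays positive semidefinite, and its kernel grows
    by one basis vector at each step.\<close>
  have "\<exists>\<phi> R. split F \<phi> R" if "finite F" for F
    using that
  proof induction
    case empty
    show ?case using D symD psdD by (intro exI[of _ "\<lambda>b u. 0"] exI[of _ D]) (simp add: split_def)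
  next
    case (insert b F)
    from insert.IH obtain \<phi> R where "split F \<phi> R" by (elim exE)
    then have \<phi>: "\<forall>b\<in>F. linear (\<phi> b)" and R: "bilinear R" "\<And>u v. R u v = R v u"
      "\<And>u. 0 \<le> R u u" and ker: "\<And>b u. b \<in> F \<Longrightarrow> R b u = 0"
      and sum: "\<And>u. D u u = R u u + (\<Sum>b\<in>F. (\<phi> b u)\<^sup>2)"
      by (auto simp: split_def)
    \<comment> \<open>\<open>S\<close> is the Schur complement. If \<open>R b b = 0\<close>,
      division by zero yields \<open>S = R\<close> and the zero form for \<open>b\<close>; this is
      correct because Cauchy-Schwarz then puts \<open>b\<close> in the kernel of \<open>R\<close>
      already.\<close>
    define S where "S u v = R u v - R b u * R b v / R b b" for u v
    define \<psi> where "\<psi> = \<phi>(b := \<lambda>u. R b u / sqrt (R b b))"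
    have lin: "linear (R u)" "linear (\<lambda>v. R v u)" for u
      using R(1) by (auto simp: bilinear_def)
    have "linear (\<lambda>u. R b u / sqrt (R b b))"
      using linear_cmult[OF lin(1), of "1 / sqrt (R b b)"] by simp
    then have lin': "linear (\<psi> c)" if "c \<in> insert b F" for c using \<phi> that by (auto simp: \<psi>_def)
    have bil': "bilinear S"
    proof -
      have "linear (\<lambda>v. S u v)" "linear (\<lambda>v. S v u)" for u
        using linear_compose_sub[OF lin(1) linear_cmult[OF lin(1), of "R b u / R b b" b]]
          linear_compose_sub[OF lin(2) linear_cmult[OF lin(1), of "R b u / R b b" b]]
        by (simp_all add: S_def mult.commute)
      then show ?thesis by (simp add: bilinear_def)
    qed
    have sym': "S u v = S v u" for u v using R(2)[of u v] by (simp add: S_def)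
    have CS: "(R b u)\<^sup>2 \<le> R b b * R u u" for u
      by (rule psd_Cauchy_Schwarz[OF R])
    have psd': "0 \<le> S u u" for u
      using CS[of u] R(3)[of b] R(3)[of u]
      by (cases "R b b = 0") (auto simp: S_def power2_eq_square divide_le_eq mult.commute)
    have ker': "S c u = 0" if "c \<in> insert b F" for c u
      using that ker[of c] R(2)[of b c] CS[of u] by (cases "R b b = 0") (auto simp: S_def)
    have sum': "D u u = S u u + (\<Sum>c\<in>insert b F. (\<psi> c u)\<^sup>2)" for u
    proof -
      have "(\<Sum>c\<in>F. (\<psi> c u)\<^sup>2) = (\<Sum>c\<in>F. (\<phi> c u)\<^sup>2)"
        using insert.hyps by (intro sum.cong) (auto simp: \<psi>_def)
      then show ?thesis
        using insert.hyps R(3)[of b] sum[of u]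
        by (simp add: S_def \<psi>_def power_divide power2_eq_square[of "R b u"])
    qed
    have "split (insert b F) \<psi> S"
      unfolding split_def
      by (intro conjI ballI allI) (erule lin' ker' | rule bil' sym' psd' sum')+
    then show ?case by blast
  qed
  from this[OF finite_Basis] obtain \<phi> R where "split Basis \<phi> R" by (elim exE)
  then have \<phi>: "\<forall>b\<in>Basis. linear (\<phi> b)" and R: "bilinear R" "\<forall>b\<in>Basis. \<forall>u. R b u = 0"
    and sum: "\<forall>u. D u u = R u u + (\<Sum>b\<in>Basis. (\<phi> b u)\<^sup>2)" by (simp_all add: split_def)
  have R0: "R u u = 0" for u
  proof -
    have "(\<lambda>v. R v u) = (\<lambda>v. 0)"
      by (rule linear_eq_stdbasis) (use R in \<open>auto simp: bilinear_def module_hom_zero\<close>)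
    then show ?thesis by (rule fun_cong)
  qed
  define g where "g u = (\<Sum>b\<in>Basis. \<phi> b u *\<^sub>R b)" for u
  have "linear (\<lambda>u. \<phi> b u *\<^sub>R b)" if "b \<in> Basis" for b
    using \<phi> that by (intro linearI) (simp_all add: linear_add linear_scale scaleR_add_left)
  then have "linear g" unfolding g_def by (intro linear_compose_sum) blast
  moreover have "D u u = (norm (g u))\<^sup>2" for u
    using sum R0 unfolding power2_norm_eq_inner euclidean_inner[of "g u" "g u"]
    by (simp add: g_def power2_eq_square)
  ultimately show ?thesis using that by blast
qed

text \<open>A compact convex set is determined by its support function, and
  \<open>c \<bullet> u + norm (f u)\<close> is that of the affine image of the ball. Each inclusion
  separates a supposed exception.\<close>

lemma support_eq_ellipsoid:
  fixes L :: "'a::euclidean_space set" and f :: "'a \<Rightarrow> 'a"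
  assumes L: "compact L" "convex L" and f: "linear f"
    and support: "\<And>u. u \<noteq> 0 \<Longrightarrow> (\<forall>y\<in>L. y \<bullet> u \<le> c \<bullet> u + norm (f u)) \<and> (\<exists>y\<in>L. y \<bullet> u = c \<bullet> u + norm (f u))"
  shows "L = (\<lambda>w. c + adjoint f w) ` cball 0 1" (is "L = ?E")
proof
  have lin: "linear (adjoint f)" by (rule adjoint_linear[OF f])
  have inner: "(c + adjoint f w) \<bullet> u = c \<bullet> u + w \<bullet> f u" for w u
    using adjoint_works[OF f, of u w] by (simp add: inner_add_right inner_commute[of _ u] inner_commute[of w])
  have E: "compact ?E" "convex ?E"
  proof -
    have "continuous_on (cball 0 1) (\<lambda>w. c + adjoint f w)"
      by (intro continuous_on_add continuous_on_const linear_continuous_on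
          linear_conv_bounded_linear[THEN iffD1] lin)
    then show "compact ?E" by (rule compact_continuous_image) simp
    have "?E = (+) c ` (adjoint f ` cball 0 1)" by (simp add: image_image)
    then show "convex ?E" by (simp add: convex_translation convex_linear_image lin)
  qed
  show "L \<subseteq> ?E"
  proof
    fix y assume y: "y \<in> L"
    show "y \<in> ?E"
    proof (rule ccontr)
      assume "y \<notin> ?E"
      then obtain a b where ab: "a \<bullet> y < b" "\<forall>x\<in>?E. b < a \<bullet> x"
        using separating_hyperplane_closed_point[OF E(2) compact_imp_closed[OF E(1)]] by blast
      define w where "w = (1 / norm (f a)) *\<^sub>R f a"
      have "- w \<in> cball 0 1" by (simp add: w_def)
      then have "b < a \<bullet> (c + adjoint f (- w))" using ab by blast
      moreover have "w \<bullet> f a = norm (f a)"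
        by (cases "f a = 0") (simp_all add: w_def dot_square_norm power2_eq_square)
      ultimately have *: "b < c \<bullet> a - norm (f a)"
        using inner[of "- w" a] by (simp add: inner_commute[of a])
      have "a \<noteq> 0" using ab * f by (auto simp: linear_0)
      then have "y \<bullet> (- a) \<le> c \<bullet> (- a) + norm (f (- a))" using support[of "- a"] y by auto
      then show False using * ab by (simp add: linear_neg[OF f] inner_commute)
    qed
  qed
  show "?E \<subseteq> L"
  proof
    fix e assume e: "e \<in> ?E"
    show "e \<in> L"
    proof (rule ccontr)
      assume "e \<notin> L"
      then obtain a b where ab: "a \<bullet> e < b" "\<forall>x\<in>L. b < a \<bullet> x"
        using separating_hyperplane_closed_point[OF L(2) compact_imp_closed[OF L(1)]] by blast
      obtain w where w: "norm w \<le> 1" "e = c + adjoint f w" using e by auto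
      have "e \<bullet> (- a) = c \<bullet> (- a) + w \<bullet> f (- a)" unfolding w(2) by (rule inner)
      also have "w \<bullet> f (- a) \<le> norm w * norm (f (- a))" by (rule norm_cauchy_schwarz)
      also have "\<dots> \<le> norm (f (- a))" using w by (simp add: mult_left_le_one_le)
      finally have le: "e \<bullet> (- a) \<le> c \<bullet> (- a) + norm (f (- a))" by simp
      show False
      proof (cases "a = 0")
        case True
        obtain b :: 'a where "b \<in> Basis" using nonempty_Basis by blast
        then obtain y where "y \<in> L" using support[of b] nonzero_Basis by blast
        then show False using True ab by force
      next
        case False
        then obtain y where "y \<in> L" "y \<bullet> (- a) = c \<bullet> (- a) + norm (f (- a))" using support[of "- a"] by auto
        then show False using le ab by (force simp: inner_commute)
      qed
    qed
  qed
qed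

text \<open>If \<open>h\<close> is the support function of \<open>L\<close>, then \<open>u\<close>
  divided by its value \<open>h\<close> lies on the polar boundary. Inserting this into
  \<open>q\<close>, dividing by the constant term and completing the square gives
  \<open>(h - m \<bullet> u)\<^sup>2 = D u u\<close>; hence \<open>D\<close> is positive
  semidefinite and factors through some \<open>g\<close>.\<close>

lemma ellipsoid_if_polar_frontier_quadric:
  fixes L :: "'a::euclidean_space set"
  assumes L: "compact L" "convex L" "0 \<in> interior L"
    and q: "quadratic q" "q p \<noteq> 0" and zero: "\<And>u. u \<in> polar_frontier L \<Longrightarrow> q u = 0"
  shows "ellipsoid DIM('a) L"
proof -
  have 0: "0 \<in> open_polar L" by (simp add: open_polar_def)
  \<comment> \<open>A zero at the origin would be a third zero on the line through \<open>p\<close>,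
    forcing \<open>q p = 0\<close>.\<close>
  have q0: "q 0 \<noteq> 0"
  proof
    assume q0: "q 0 = 0"
    have "p \<noteq> 0" using q q0 by auto
    then have "- p \<noteq> 0" by simp
    obtain s where s: "0 < s" "0 + s *\<^sub>R p \<in> polar_frontier L"
      using open_polar_ray[OF L(1,3) 0 \<open>p \<noteq> 0\<close>] .
    obtain t where t: "0 < t" "0 + t *\<^sub>R (- p) \<in> polar_frontier L"
      using open_polar_ray[OF L(1,3) 0 \<open>- p \<noteq> 0\<close>] .
    have "q (0 + s *\<^sub>R p) = 0" "q (0 - t *\<^sub>R p) = 0"
      using zero[OF s(2)] zero[OF t(2)] by simp_all
    from quadratic_zero_on_line[OF q(1) q0 this s(1) t(1), of 1] have "q (0 + 1 *\<^sub>R p) = 0" .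
    then show False using q by simp
  qed
  obtain B l k where *: "bilinear B" "linear l" "q = (\<lambda>u. B u u + l u + k)"
    using q(1) unfolding quadratic_def by blast
  have k: "k \<noteq> 0" using q0 by (simp add: * bilinear_lzero[OF *(1)] linear_0[OF *(2)])
  define m where "m = (- 1 / (2 * k)) *\<^sub>R adjoint l 1"
  have m: "l u = - 2 * k * (m \<bullet> u)" for u
    using adjoint_works[OF *(2), of u 1] k by (simp add: m_def inner_commute)
  define D where "D u v = - (B u v + B v u) / (2 * k) + (m \<bullet> u) * (m \<bullet> v)" for u v
  have D: "bilinear D"
  proof -
    have lin: "linear (\<lambda>v. D u v)" for u
      using *(1) by (intro linearI) (simp_all add: D_def bilinear_ladd bilinear_radd bilinear_lmul
          bilinear_rmul inner_add_right add_divide_distrib diff_divide_distrib algebra_simps)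
    moreover have "D v u = D u v" for u v by (simp add: D_def mult.commute add.commute)
    ultimately show ?thesis by (simp add: bilinear_def)
  qed
  have symD: "D u v = D v u" for u v by (simp add: D_def mult.commute add.commute)
  have ex: "\<exists>h>0. (\<forall>y\<in>L. y \<bullet> u \<le> h) \<and> (\<exists>y\<in>L. y \<bullet> u = h) \<and> (h - m \<bullet> u)\<^sup>2 = D u u"
    if u: "u \<noteq> 0" for u
  proof -
    obtain t where t: "0 < t" "0 + t *\<^sub>R u \<in> polar_frontier L"
      using open_polar_ray[OF L(1,3) 0 u] .
    have "q (t *\<^sub>R u) = 0" using zero t by simp
    then have "B u u * t\<^sup>2 - 2 * k * (m \<bullet> u) * t + k = 0"
      by (simp add: * m bilinear_lmul[OF *(1)] bilinear_rmul[OF *(1)] power2_eq_square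
          inner_add_right flip: m) (simp add: m algebra_simps)
    then have "B u u / k = 2 * (m \<bullet> u) / t - 1 / t\<^sup>2" using t k by (simp add: field_simps power2_eq_square)
    moreover have "D u u = - (B u u / k) + (m \<bullet> u)\<^sup>2"
      using k by (simp add: D_def power2_eq_square field_simps)
    ultimately have "(1 / t - m \<bullet> u)\<^sup>2 = D u u"
      by (simp add: power2_eq_square algebra_simps)
    moreover have "\<forall>y\<in>L. y \<bullet> u \<le> 1 / t" "\<exists>y\<in>L. y \<bullet> u = 1 / t"
      using t by (auto simp: polar_frontier_def field_simps)
    ultimately show ?thesis using t by (intro exI[of _ "1 / t"]) simp
  qed
  have "0 \<le> D u u" for u
    using ex[of u] bilinear_lzero[OF D, of u] by (metis order_refl zero_le_power2)
  then obtain g :: "'a \<Rightarrow> 'a" where g: "linear g" "\<And>u. D u u = (norm (g u))\<^sup>2"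
    using psd_factor[OF D symD] by blast
  have "(\<forall>y\<in>L. y \<bullet> u \<le> m \<bullet> u + norm (g u)) \<and> (\<exists>y\<in>L. y \<bullet> u = m \<bullet> u + norm (g u))"
    if u: "u \<noteq> 0" for u
  proof -
    obtain h where h: "h > 0" "\<forall>y\<in>L. y \<bullet> u \<le> h" "\<exists>y\<in>L. y \<bullet> u = h" "(h - m \<bullet> u)\<^sup>2 = (norm (g u))\<^sup>2"
      using ex[OF u] g by auto
    \<comment> \<open>The opposite direction fixes the sign of the root:
      \<open>h - m \<bullet> u\<close> and \<open>h' + m \<bullet> u\<close> have equal absolute
      values and a positive sum, so both equal \<open>norm (g u)\<close>.\<close>
    obtain h' where h': "h' > 0" "(h' - m \<bullet> (- u))\<^sup>2 = (norm (g (- u)))\<^sup>2"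
      using ex[of "- u"] u g by auto
    have "\<bar>h - m \<bullet> u\<bar> = norm (g u)" using h(4) by (metis abs_norm_cancel real_sqrt_abs)
    moreover have "(h' + m \<bullet> u)\<^sup>2 = (norm (g u))\<^sup>2"
      using h'(2) by (simp add: linear_neg[OF g(1)])
    then have "\<bar>h' + m \<bullet> u\<bar> = norm (g u)" by (metis abs_norm_cancel real_sqrt_abs)
    ultimately have "h = m \<bullet> u + norm (g u)" using h(1) h'(1) by linarith
    with h show ?thesis by simp
  qed
  then have "L = (\<lambda>w. m + adjoint g w) ` cball 0 1"
    by (rule support_eq_ellipsoid[OF L(1,2) g(1)])
  moreover have "aff_dim L = int DIM('a)"
    using aff_dim_nonempty_interior[of L] L(3) by auto
  ultimately show ?thesis
    unfolding ellipsoid_def using adjoint_linear[OF g(1)] by blast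
qed

section \<open>From grazes to quadratic sections\<close>

lemma graze_touching_points:
  fixes L :: "'a::euclidean_space set"
  assumes L: "compact L" "convex L" and E: "ellipsoid k E" "1 \<le> k" "graze L x = rel_frontier E"
  obtains c and f :: "'a \<Rightarrow> 'a" where "linear f" "\<And>w. norm w \<le> 1 \<Longrightarrow> c + f w \<in> L"
    "\<And>v y. v \<noteq> 0 \<Longrightarrow> y \<in> L \<Longrightarrow> \<forall>z\<in>L. z \<bullet> v \<le> x \<bullet> v \<Longrightarrow> y \<bullet> v = x \<bullet> v \<Longrightarrow>
      \<exists>w. norm w \<le> 1 \<and> y = c + f w"
proof -
  obtain c and f :: "'a \<Rightarrow> 'a" where f: "linear f" and Eeq: "E = (\<lambda>u. c + f u) ` cball 0 1"
    and affE: "aff_dim E = int k"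
    using E(1) unfolding ellipsoid_def by blast
  have "continuous_on (cball 0 1) (\<lambda>w. c + f w)"
    by (intro continuous_on_add continuous_on_const linear_continuous_on
        linear_conv_bounded_linear[THEN iffD1] f)
  then have compE: "compact E" unfolding Eeq by (rule compact_continuous_image) simp
  have "E = (+) c ` (f ` cball 0 1)" by (simp add: Eeq image_image)
  then have convE: "convex E" by (simp add: convex_translation convex_linear_image f)
  have frL: "rel_frontier E \<subseteq> L"
    using E(3) compact_imp_closed[OF L(1)] frontier_subset_closed unfolding graze_def by blast
  have frE: "rel_frontier E \<subseteq> E"
    using compact_imp_closed[OF compE] by (auto simp: rel_frontier_def)
  \<comment> \<open>As \<open>E\<close> is not a single point, its extreme points lie on its
    relative boundary, hence in the graze and in \<open>L\<close>. Their convex hull is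
    \<open>E\<close>, so \<open>E\<close> lies in \<open>L\<close>.\<close>
  have "E \<noteq> {p}" for p using affE E(2) by auto
  then have "{p. p extreme_point_of E} \<subseteq> rel_frontier E"
    using extreme_point_not_in_REL_INTERIOR[of _ E] closure_subset
    by (auto simp: rel_frontier_def extreme_point_of_def)
  then have "convex hull {p. p extreme_point_of E} \<subseteq> L"
    using frL L(2) by (intro hull_minimal) auto
  then have EL: "E \<subseteq> L" using Krein_Milman_Minkowski[OF compE convE] by simp
  \<comment> \<open>The half-space bounded by a supporting hyperplane through \<open>x\<close>
    contains \<open>L\<close> and also the cone. Points of contact with \<open>L\<close> are
    therefore frontier points of both, that is, points of the graze.\<close>
  have "y \<in> E" if v: "v \<noteq> 0" and y: "y \<in> L" "\<forall>z\<in>L. z \<bullet> v \<le> x \<bullet> v" "y \<bullet> v = x \<bullet> v" for v y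
  proof -
    have max: "y \<notin> interior S" if "S \<subseteq> {z. v \<bullet> z \<le> v \<bullet> x}" for S
      using interior_mono[OF that] y(3) unfolding interior_halfspace_le[OF v]
      by (auto simp: inner_commute[of _ v])
    have "v \<bullet> (x + t *\<^sub>R (z - x)) \<le> v \<bullet> x" if "z \<in> L" "0 \<le> t" for z t
    proof -
      have "t * (v \<bullet> (z - x)) \<le> 0"
        using y(2) that by (intro mult_nonneg_nonpos) (auto simp: inner_diff_right inner_commute)
      then show ?thesis by (simp add: inner_add_right)
    qed
    then have "cone_from L x \<subseteq> {z. v \<bullet> z \<le> v \<bullet> x}" unfolding cone_from_def by blast
    moreover have "L \<subseteq> {z. v \<bullet> z \<le> v \<bullet> x}" using y(2) by (auto simp: inner_commute)
    moreover have "y = x + 1 *\<^sub>R (y - x)" by simp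
    then have "y \<in> cone_from L x" using y(1) unfolding cone_from_def by fastforce
    ultimately have "y \<in> graze L x"
      using y(1) max closure_subset unfolding graze_def support_cone_def frontier_def by blast
    then show ?thesis using E(3) frE by blast
  qed
  then show ?thesis
    using that[of f c] f EL unfolding Eeq by (simp add: image_iff subset_iff) (metis mem_cball_0)
qed

text \<open>If the hyperplane dual to \<open>u\<close> passes through \<open>x\<close> and supports
  \<open>L\<close>, the contact point lies in the ellipsoid, which is contained in \<open>L\<close>.
  So both support functions equal 1 at \<open>u\<close>, that is,
  \<open>norm (g u) = 1 - c \<bullet> u\<close>; squaring gives \<open>Q u = 0\<close>. At
  \<open>p\<close> the inequality is strict, so \<open>Q p\<close> is negative and can be scaled to
  -1.\<close>

lemma touching_ellipsoid_quadratic: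
  fixes f :: "'a::euclidean_space \<Rightarrow> 'a"
  assumes f: "linear f" and inL: "\<And>w. norm w \<le> 1 \<Longrightarrow> c + f w \<in> L"
    and touch: "\<And>v y. v \<noteq> 0 \<Longrightarrow> y \<in> L \<Longrightarrow> \<forall>z\<in>L. z \<bullet> v \<le> x \<bullet> v \<Longrightarrow> y \<bullet> v = x \<bullet> v \<Longrightarrow>
      \<exists>w. norm w \<le> 1 \<and> y = c + f w"
    and p: "p \<in> open_polar L"
  shows "\<exists>q. quadratic q \<and> q p = - 1 \<and> (\<forall>u\<in>polar_frontier L. x \<bullet> u = 1 \<longrightarrow> q u = 0)"
proof -
  define g where "g = adjoint f"
  have g: "linear g" unfolding g_def by (rule adjoint_linear[OF f])
  have inner: "(c + f w) \<bullet> u = c \<bullet> u + w \<bullet> g u" for w u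
    using adjoint_works[OF f, of w u] by (simp add: g_def inner_add_left)
  have top: "\<exists>w. norm w \<le> 1 \<and> (c + f w) \<bullet> u = c \<bullet> u + norm (g u)" for u
  proof (intro exI conjI)
    have "((1 / norm (g u)) *\<^sub>R g u) \<bullet> g u = norm (g u)"
      by (cases "g u = 0") (simp_all add: dot_square_norm power2_eq_square)
    then show "(c + f ((1 / norm (g u)) *\<^sub>R g u)) \<bullet> u = c \<bullet> u + norm (g u)" by (simp add: inner)
  qed simp
  define Q where "Q u = g u \<bullet> g u - (c \<bullet> u + (- 1)) * (c \<bullet> u + (- 1))" for u
  have lin: "linear (\<lambda>u. c \<bullet> u)"
    by (simp add: bounded_linear.linear bounded_linear_inner_right)
  have Q: "quadratic Q"
    unfolding Q_def by (intro quadratic_diff quadratic_inner quadratic_mult g lin)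
  have Qeq: "Q u = (norm (g u))\<^sup>2 - (1 - c \<bullet> u)\<^sup>2" for u
    unfolding Q_def power2_norm_eq_inner by (simp add: power2_eq_square algebra_simps)
  have neg: "Q p < 0"
  proof -
    obtain w where "norm w \<le> 1" "(c + f w) \<bullet> p = c \<bullet> p + norm (g p)" using top by blast
    then have "norm (g p) < 1 - c \<bullet> p" using inL[of w] p by (auto simp: open_polar_def)
    then have "(norm (g p))\<^sup>2 < (1 - c \<bullet> p)\<^sup>2" by (intro power_strict_mono) auto
    then show ?thesis by (simp add: Qeq)
  qed
  have zero: "Q u = 0" if u: "u \<in> polar_frontier L" "x \<bullet> u = 1" for u
  proof -
    obtain y where y: "y \<in> L" "y \<bullet> u = 1" using u by (auto simp: polar_frontier_def)
    have "u \<noteq> 0" using u by auto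
    then obtain w where w: "norm w \<le> 1" "y = c + f w"
      using touch[of u y] u y by (auto simp: polar_frontier_def)
    have "w \<bullet> g u \<le> norm w * norm (g u)" by (rule norm_cauchy_schwarz)
    also have "\<dots> \<le> norm (g u)" using w by (simp add: mult_left_le_one_le)
    finally have "1 \<le> c \<bullet> u + norm (g u)" using y(2) inner[of w u] w by simp
    moreover obtain w' where "norm w' \<le> 1" "(c + f w') \<bullet> u = c \<bullet> u + norm (g u)" using top by blast
    then have "c \<bullet> u + norm (g u) \<le> 1" using inL[of w'] u(1) by (auto simp: polar_frontier_def)
    ultimately have "norm (g u) = 1 - c \<bullet> u" by simp
    then show ?thesis by (simp add: Qeq)
  qed
  show ?thesis
    using quadratic_cmult[OF Q, of "- 1 / Q p"] neg zero
    by (intro exI[of _ "\<lambda>u. (- 1 / Q p) * Q u"]) simp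
qed

theorem theorem5:
  fixes K L :: "(real ^ 'n) set"
  assumes "CARD('n) \<ge> 3"
    and "convex_body K" and "convex_body L"
    and "L \<subseteq> interior K"
    and "\<forall>x \<in> frontier K. \<exists>a b E. a \<noteq> 0 \<and> E \<subseteq> {y. a \<bullet> y = b} \<and>
           ellipsoid (CARD('n) - 1) E \<and> graze L x = rel_frontier E"
  shows "ellipsoid CARD('n) L"
proof -
  have K: "compact K" "convex K" and L: "compact L" "convex L" "interior L \<noteq> {}"
    using assms(2,3) by (auto simp: convex_body_def)
  obtain a where a: "a \<in> interior L" using L(3) by blast
  \<comment> \<open>An interior point of \<open>L\<close> is moved to the origin, as the passage to
    the polar body requires.\<close>
  define K' L' where "K' = (+) (- a) ` K" and "L' = (+) (- a) ` L"
  have K': "compact K'" "convex K'" and L': "compact L'" "convex L'"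
    unfolding K'_def L'_def by (intro compact_translation convex_translation K L)+
  have "- a + a \<in> interior L'" unfolding L'_def interior_translation by (rule imageI[OF a])
  then have 0: "0 \<in> interior L'" by simp
  have sub: "L' \<subseteq> interior K'"
    using assms(4) unfolding K'_def L'_def interior_translation by blast
  interpret quadratic_sections K' L'
  proof
    show "3 \<le> DIM(real ^ 'n)" using assms(1) by simp
    fix x p assume x: "x \<in> frontier K'" and p: "p \<in> open_polar L'"
    have "x \<in> (+) (- a) ` frontier K" using x unfolding K'_def frontier_translation .
    then have "a + x \<in> frontier K" by auto
    then obtain E where E: "ellipsoid (CARD('n) - 1) E" "graze L (a + x) = rel_frontier E"
      using assms(5) by blast
    have card: "1 \<le> CARD('n) - 1" using assms(1) by simp
    obtain c and f :: "real ^ 'n \<Rightarrow> real ^ 'n" where f: "linear f" and inL: "\<And>w. norm w \<le> 1 \<Longrightarrow> c + f w \<in> L"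
      and touch: "\<And>v y. v \<noteq> 0 \<Longrightarrow> y \<in> L \<Longrightarrow> \<forall>z\<in>L. z \<bullet> v \<le> (a + x) \<bullet> v \<Longrightarrow> y \<bullet> v = (a + x) \<bullet> v \<Longrightarrow>
        \<exists>w. norm w \<le> 1 \<and> y = c + f w"
      by (rule graze_touching_points[OF L(1,2) E(1) card E(2)]) (rule that)
    show "\<exists>q. quadratic q \<and> q p = - 1 \<and> (\<forall>u\<in>polar_frontier L'. x \<bullet> u = 1 \<longrightarrow> q u = 0)"
    proof (rule touching_ellipsoid_quadratic[OF f _ _ p, of "c - a" x])
      show "c - a + f w \<in> L'" if "norm w \<le> 1" for w
        using inL[OF that] unfolding L'_def by (auto simp: image_iff intro!: bexI[of _ "c + f w"])
      show "\<exists>w. norm w \<le> 1 \<and> y = c - a + f w"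
        if v: "v \<noteq> 0" and y: "y \<in> L'" "\<forall>z\<in>L'. z \<bullet> v \<le> x \<bullet> v" "y \<bullet> v = x \<bullet> v" for v y
      proof -
        have "a + y \<in> L" using y(1) by (auto simp: L'_def)
        moreover have "\<forall>z\<in>L. z \<bullet> v \<le> (a + x) \<bullet> v"
          using y(2) by (auto simp: L'_def inner_add_left inner_diff_left)
        moreover have "(a + y) \<bullet> v = (a + x) \<bullet> v" using y(3) by (simp add: inner_add_left)
        ultimately obtain w where "norm w \<le> 1" "a + y = c + f w" using touch[OF v] by blast
        then show ?thesis by (intro exI[of _ w]) (simp add: algebra_simps)
      qed
    qed
  qed (use K' L' 0 sub in auto)
  obtain q p where "quadratic q" "q p \<noteq> 0" "\<And>u. u \<in> polar_frontier L' \<Longrightarrow> q u = 0"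
    using polar_frontier_quadric by blast
  then have "ellipsoid CARD('n) L'"
    using ellipsoid_if_polar_frontier_quadric[OF L' 0] by simp
  then obtain c and f :: "real ^ 'n \<Rightarrow> real ^ 'n" where f: "linear f"
    "L' = (\<lambda>u. c + f u) ` cball 0 1" "aff_dim L' = int CARD('n)"
    unfolding ellipsoid_def by blast
  have eq: "L = (+) a ` L'" by (simp add: L'_def image_image)
  then have "L = (\<lambda>u. (a + c) + f u) ` cball 0 1" by (simp add: f(2) image_image add.assoc)
  moreover have "aff_dim L = int CARD('n)" using f(3) by (simp only: eq aff_dim_translation_eq)
  ultimately show ?thesis unfolding ellipsoid_def using f(1) by blast
qed

end
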